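(* Let $R$ be a ring and let $J$ be a complete ideal filter of $R$. Every left $R$-module $M$ admits a $J$-hull. Moreover, the following holds for any $J$-hull $\iota:M\hookrightarrow\Omega$ of $M$: 1. for every $J$-extension $i:M\hookrightarrow N$ there is a $J$-hull $j:N\hookrightarrow\Omega$ with $j\circ i=\iota$; 2. for every $J$-hull $\iota':M\hookrightarrow\Omega'$ there is an isomorphism $\varphi:\Omega\to\Omega'$ with $\varphi\circ\iota=\iota'$.
   Context: Rings are unitary, not necessarily commutative; modules are left modules. An ideal filter of $R$ is a non-empty set $J$ of right ideals of $R$ closed under pairwise intersection and such that any right ideal containing an element of $J$ is in $J$. For left $R$-modules $A\subseteq B$, $(A:_BJ):=\{x\in B\mid Ix\subseteq A\text{ for some }I\in J\}$, a submodule of $B$. $J$ is complete if $((A:_BJ):_BJ)=(A:_BJ)$ for all left $R$-modules $A\subseteq B$. A $J$-extension is an injective $R$-homomorphism $i:A\hookrightarrow B$ with $(i(A):_BJ)=B$. A left $R$-module $Q$ is $J$-injective if for every $J$-extension $i:A\hookrightarrow B$ and every $R$-homomorphism $f:A\to Q$ there is an $R$-homomorphism $g:B\to Q$ with $g\circ i=f$. An injective homomorphism $f:A\hookrightarrow B$ is an essential extension if every submodule $B'\subseteq B$ with $B'\cap f(A)=0$ is zero. A $J$-hull of $M$ is a $J$-extension $\iota:M\hookrightarrow\Omega$ that is an essential extension and such that $\Omega$ is $J$-injective.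
   Formalization: Item 1 is proved only for J-extensions i that are also essential; as printed it fails (R=ℤ, J the nonzero ideals, M=0, N=ℤ/2), and any such j forces i essential. Completeness and J-injectivity are tested on modules over one arbitrary carrier type containing R, which suffices. *)

theory Defs
  imports Complex_Main "HOL-Algebra.Module" "HOL-Algebra.Ideal"
begin

text \<open>
  The locale \<^locale>\<open>module\<close> demands a commutative ring of scalars, so left modules over an
  arbitrary ring get their own locale, with the same record type and the same axioms.  The zero
  ring is allowed.  The library predicate \<^locale>\<open>submodule\<close> only says "additive subgroup closed
  under scalars"; it does not need commutativity and is reused.
\<close>

locale left_module = R?: ring R + M?: abelian_group M for R (structure) and M (structure) +
  assumes smult_closed [simp, intro]:
      "\<lbrakk>a \<in> carrier R; x \<in> carrier M\<rbrakk> \<Longrightarrow> a \<odot>\<^bsub>M\<^esub> x \<in> carrier M"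
    and smult_l_distr:
      "\<lbrakk>a \<in> carrier R; b \<in> carrier R; x \<in> carrier M\<rbrakk> \<Longrightarrow>
        (a \<oplus> b) \<odot>\<^bsub>M\<^esub> x = a \<odot>\<^bsub>M\<^esub> x \<oplus>\<^bsub>M\<^esub> b \<odot>\<^bsub>M\<^esub> x"
    and smult_r_distr:
      "\<lbrakk>a \<in> carrier R; x \<in> carrier M; y \<in> carrier M\<rbrakk> \<Longrightarrow>
        a \<odot>\<^bsub>M\<^esub> (x \<oplus>\<^bsub>M\<^esub> y) = a \<odot>\<^bsub>M\<^esub> x \<oplus>\<^bsub>M\<^esub> a \<odot>\<^bsub>M\<^esub> y"
    and smult_assoc1:
      "\<lbrakk>a \<in> carrier R; b \<in> carrier R; x \<in> carrier M\<rbrakk> \<Longrightarrow>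
        (a \<otimes> b) \<odot>\<^bsub>M\<^esub> x = a \<odot>\<^bsub>M\<^esub> (b \<odot>\<^bsub>M\<^esub> x)"
    and smult_one [simp]:
      "x \<in> carrier M \<Longrightarrow> \<one> \<odot>\<^bsub>M\<^esub> x = x"

text \<open>
  Homomorphisms are total HOL functions of which only the values on the carrier matter;
  accordingly, equations between composites are always stated on the carrier of the source.
\<close>

definition left_module_hom ::
    "('r, 'c) ring_scheme \<Rightarrow> ('r, 'a, 'd) module_scheme \<Rightarrow> ('r, 'b, 'e) module_scheme \<Rightarrow> ('a \<Rightarrow> 'b) set"
  where "left_module_hom R A B =
    {f \<in> carrier A \<rightarrow> carrier B.
       (\<forall>x\<in>carrier A. \<forall>y\<in>carrier A. f (x \<oplus>\<^bsub>A\<^esub> y) = f x \<oplus>\<^bsub>B\<^esub> f y) \<and>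
       (\<forall>r\<in>carrier R. \<forall>x\<in>carrier A. f (r \<odot>\<^bsub>A\<^esub> x) = r \<odot>\<^bsub>B\<^esub> f x)}"

definition right_ideal :: "'r set \<Rightarrow> ('r, 'c) ring_scheme \<Rightarrow> bool"
  where "right_ideal I R \<longleftrightarrow>
    additive_subgroup I R \<and> (\<forall>a\<in>I. \<forall>r\<in>carrier R. a \<otimes>\<^bsub>R\<^esub> r \<in> I)"

definition ideal_filter :: "('r, 'c) ring_scheme \<Rightarrow> 'r set set \<Rightarrow> bool"
  where "ideal_filter R J \<longleftrightarrow>
    J \<noteq> {} \<and> (\<forall>I\<in>J. right_ideal I R) \<and>
    (\<forall>I\<in>J. \<forall>I'\<in>J. I \<inter> I' \<in> J) \<and>
    (\<forall>I\<in>J. \<forall>I'. right_ideal I' R \<and> I \<subseteq> I' \<longrightarrow> I' \<in> J)"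

text \<open>The submodule \<open>(A :\<^sub>B J)\<close>; here \<open>A\<close> is the underlying set of a submodule of \<open>B\<close>.\<close>

definition filter_colon :: "'b set \<Rightarrow> ('r, 'b, 'd) module_scheme \<Rightarrow> 'r set set \<Rightarrow> 'b set"
  where "filter_colon A B J = {x \<in> carrier B. \<exists>I\<in>J. \<forall>a\<in>I. a \<odot>\<^bsub>B\<^esub> x \<in> A}"

text \<open>
  Completeness and \<open>J\<close>-injectivity quantify over all left modules, while a HOL formula can only
  quantify over the modules carried by one type.  That type is the parameter \<open>'u\<close> of
  \<open>complete_filter\<close> and \<open>J_injective\<close>.  It must be large enough to carry a copy of \<open>R\<close> (for
  \<open>'u = unit\<close> the conditions are vacuous), so they are meant to be used at types \<open>'r + 'u\<close> with
  \<open>'u\<close> arbitrary.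
\<close>

definition complete_filter :: "'u itself \<Rightarrow> ('r, 'c) ring_scheme \<Rightarrow> 'r set set \<Rightarrow> bool"
  where "complete_filter (U :: 'u itself) R J \<longleftrightarrow>
    (\<forall>(B :: ('r, 'u) module) A. left_module R B \<and> submodule A R B \<longrightarrow>
       filter_colon (filter_colon A B J) B J = filter_colon A B J)"

definition J_extension ::
    "('r, 'c) ring_scheme \<Rightarrow> 'r set set \<Rightarrow> ('r, 'a, 'd) module_scheme \<Rightarrow> ('r, 'b, 'e) module_scheme \<Rightarrow>
      ('a \<Rightarrow> 'b) \<Rightarrow> bool"
  where "J_extension R J A B i \<longleftrightarrow>
    left_module R A \<and> left_module R B \<and>
    i \<in> left_module_hom R A B \<and> inj_on i (carrier A) \<and>
    filter_colon (i ` carrier A) B J = carrier B"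

definition J_injective ::
    "'u itself \<Rightarrow> ('r, 'c) ring_scheme \<Rightarrow> 'r set set \<Rightarrow> ('r, 'q, 'd) module_scheme \<Rightarrow> bool"
  where "J_injective (U :: 'u itself) R J Q \<longleftrightarrow>
    left_module R Q \<and>
    (\<forall>(A :: ('r, 'u) module) (B :: ('r, 'u) module) i f.
       J_extension R J A B i \<and> f \<in> left_module_hom R A Q \<longrightarrow>
       (\<exists>g \<in> left_module_hom R B Q. \<forall>x\<in>carrier A. g (i x) = f x))"

definition essential_extension ::
    "('r, 'c) ring_scheme \<Rightarrow> ('r, 'a, 'd) module_scheme \<Rightarrow> ('r, 'b, 'e) module_scheme \<Rightarrow>
      ('a \<Rightarrow> 'b) \<Rightarrow> bool"
  where "essential_extension R A B f \<longleftrightarrow>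
    left_module R A \<and> left_module R B \<and>
    f \<in> left_module_hom R A B \<and> inj_on f (carrier A) \<and>
    (\<forall>B'. submodule B' R B \<and> B' \<inter> f ` carrier A = {\<zero>\<^bsub>B\<^esub>} \<longrightarrow> B' = {\<zero>\<^bsub>B\<^esub>})"

definition J_hull ::
    "'u itself \<Rightarrow> ('r, 'c) ring_scheme \<Rightarrow> 'r set set \<Rightarrow> ('r, 'a, 'd) module_scheme \<Rightarrow>
      ('r, 'b, 'e) module_scheme \<Rightarrow> ('a \<Rightarrow> 'b) \<Rightarrow> bool"
  where "J_hull U R J M \<Omega> \<iota> \<longleftrightarrow>
    J_extension R J M \<Omega> \<iota> \<and> essential_extension R M \<Omega> \<iota> \<and> J_injective U R J \<Omega>"

text \<open>
  Existence of a hull requires naming a type that carries it.  With \<open>M\<close> carried by \<open>'m\<close>, the type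
  \<open>('m \<Rightarrow> complex) \<Rightarrow> 'r \<Rightarrow> complex\<close> is big enough: sending \<open>x\<close> to \<open>\<lambda>\<chi> r. \<chi> (r x)\<close> embeds \<open>M\<close> into
  the injective module given by the product, over all characters \<open>\<chi>\<close> from \<open>M\<close> to the multiplicative
  group of the complex numbers, of the groups of additive-to-multiplicative characters of \<open>R\<close>.
\<close>

lemma left_module_hom_zero:
  assumes "left_module R A" "left_module R B" "f \<in> left_module_hom R A B"
  shows "f \<zero>\<^bsub>A\<^esub> = \<zero>\<^bsub>B\<^esub>"
proof -
  interpret A: left_module R A by fact
  interpret B: left_module R B by fact
  have c: "f \<zero>\<^bsub>A\<^esub> \<in> carrier B"
    using assms(3) by (auto simp: left_module_hom_def)
  have "f (x \<oplus>\<^bsub>A\<^esub> y) = f x \<oplus>\<^bsub>B\<^esub> f y" if "x \<in> carrier A" "y \<in> carrier A" for x y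
    using assms(3) that by (simp add: left_module_hom_def)
  from this[OF A.M.zero_closed A.M.zero_closed]
  have "f \<zero>\<^bsub>A\<^esub> = f \<zero>\<^bsub>A\<^esub> \<oplus>\<^bsub>B\<^esub> f \<zero>\<^bsub>A\<^esub>"
    by (simp only: A.M.l_zero[OF A.M.zero_closed])
  then show ?thesis using c
    using B.M.add.r_cancel_one'[of "f \<zero>\<^bsub>A\<^esub>" "f \<zero>\<^bsub>A\<^esub>"] by auto
qed

lemma left_module_hom_image_submodule:
  assumes A: "left_module R A" and B: "left_module R B" and f: "f \<in> left_module_hom R A B"
    and S: "submodule S R A"
  shows "submodule (f ` S) R B"
proof -
  interpret A: left_module R A by fact
  interpret B: left_module R B by fact
  interpret S: submodule S R A by fact
  have SA: "S \<subseteq> carrier A" using S.subset by simp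
  have fc: "f x \<in> carrier B" if "x \<in> carrier A" for x
    using f that by (auto simp: left_module_hom_def)
  have fadd: "f (x \<oplus>\<^bsub>A\<^esub> y) = f x \<oplus>\<^bsub>B\<^esub> f y" if "x \<in> carrier A" "y \<in> carrier A" for x y
    using f that by (auto simp: left_module_hom_def)
  have fsm: "f (r \<odot>\<^bsub>A\<^esub> x) = r \<odot>\<^bsub>B\<^esub> f x" if "r \<in> carrier R" "x \<in> carrier A" for r x
    using f that by (auto simp: left_module_hom_def)
  have neg: "\<ominus>\<^bsub>A\<^esub> x \<in> S" if "x \<in> S" for x
    using S.m_inv_closed[OF that] by (simp add: a_inv_def)
  have fneg: "f (\<ominus>\<^bsub>A\<^esub> x) = \<ominus>\<^bsub>B\<^esub> f x" if x: "x \<in> carrier A" for x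
  proof -
    have "f (\<ominus>\<^bsub>A\<^esub> x) \<oplus>\<^bsub>B\<^esub> f x = \<zero>\<^bsub>B\<^esub>"
      using x fadd[of "\<ominus>\<^bsub>A\<^esub> x" x] left_module_hom_zero[OF A B f] by (simp add: A.M.l_neg)
    then show ?thesis by (rule B.M.minus_equality[symmetric]) (use x fc in auto)
  qed
  show ?thesis
  proof (intro submodule.intro subgroup.intro submodule_axioms.intro)
    show "f ` S \<subseteq> carrier (add_monoid B)" using SA fc by auto
    show "\<one>\<^bsub>add_monoid B\<^esub> \<in> f ` S"
      using imageI[OF S.one_closed, of f] left_module_hom_zero[OF A B f] by simp
  next
    fix x y assume "x \<in> f ` S" "y \<in> f ` S"
    then obtain a b where ab: "a \<in> S" "b \<in> S" "x = f a" "y = f b" by blast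
    then have "x \<otimes>\<^bsub>add_monoid B\<^esub> y = f (a \<oplus>\<^bsub>A\<^esub> b)" using SA fadd by (simp add: subset_eq)
    moreover have "a \<oplus>\<^bsub>A\<^esub> b \<in> S" using ab S.m_closed by simp
    ultimately show "x \<otimes>\<^bsub>add_monoid B\<^esub> y \<in> f ` S" by (simp only: imageI)
  next
    fix x assume "x \<in> f ` S"
    then obtain a where a: "a \<in> S" "x = f a" by blast
    then have "inv\<^bsub>add_monoid B\<^esub> x = f (\<ominus>\<^bsub>A\<^esub> a)"
      using SA fneg by (simp add: subset_eq a_inv_def)
    then show "inv\<^bsub>add_monoid B\<^esub> x \<in> f ` S" using neg[OF a(1)] by (simp only: imageI)
  next
    fix r x assume r: "r \<in> carrier R" and "x \<in> f ` S"
    then obtain a where a: "a \<in> S" "x = f a" by blast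
    then have "r \<odot>\<^bsub>B\<^esub> x = f (r \<odot>\<^bsub>A\<^esub> a)" using SA r fsm by (simp add: subset_eq)
    then show "r \<odot>\<^bsub>B\<^esub> x \<in> f ` S" using S.smult_closed[OF r a(1)] by (simp only: imageI)
  qed
qed

text \<open>
  If \<open>M \<subseteq> \<Omega>\<close> is essential, only essential extensions of \<open>M\<close> embed into \<open>\<Omega>\<close> over \<open>M\<close>.  Note that
  \<^const>\<open>J_extension\<close> does not imply \<^const>\<open>essential_extension\<close>: adding to \<open>M\<close> a direct summand
  in which every element is killed by a member of \<open>J\<close> gives a \<open>J\<close>-extension of \<open>M\<close>.
  Hence extending a \<open>J\<close>-extension of \<open>M\<close> to a hull inside \<open>\<Omega>\<close> is only possible when it is essential.
\<close>

lemma essential_extension_factor: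
  assumes ess: "essential_extension R M \<Omega> \<iota>"
    and i: "left_module R N" "i \<in> left_module_hom R M N"
    and j: "j \<in> left_module_hom R N \<Omega>" "inj_on j (carrier N)"
    and ji: "\<forall>x\<in>carrier M. j (i x) = \<iota> x"
  shows "essential_extension R M N i"
proof -
  have M: "left_module R M" and W: "left_module R \<Omega>" and iinj: "inj_on \<iota> (carrier M)"
    using ess by (auto simp: essential_extension_def)
  interpret N: left_module R N by fact
  have ic: "i ` carrier M \<subseteq> carrier N" using i(2) by (auto simp: left_module_hom_def)
  have j0: "j \<zero>\<^bsub>N\<^esub> = \<zero>\<^bsub>\<Omega>\<^esub>" using left_module_hom_zero[OF i(1) W j(1)] .
  have "B' = {\<zero>\<^bsub>N\<^esub>}" if B': "submodule B' R N" "B' \<inter> i ` carrier M = {\<zero>\<^bsub>N\<^esub>}" for B'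
  proof -
    interpret B': submodule B' R N by fact
    have sub: "B' \<subseteq> carrier N" using B'.subset by simp
    have "\<iota> ` carrier M = j ` i ` carrier M" unfolding image_image using ji by (intro image_cong) simp_all
    then have "j ` B' \<inter> \<iota> ` carrier M = j ` (B' \<inter> i ` carrier M)"
      using inj_on_image_Int[OF j(2) sub ic] by simp
    also have "\<dots> = {\<zero>\<^bsub>\<Omega>\<^esub>}" using B'(2) j0 by simp
    finally have "j ` B' = {\<zero>\<^bsub>\<Omega>\<^esub>}"
      using ess left_module_hom_image_submodule[OF i(1) W j(1) B'(1)]
      by (auto simp: essential_extension_def)
    then have "j ` B' = j ` {\<zero>\<^bsub>N\<^esub>}" using j0 by (simp only: image_insert image_empty)
    moreover have "{\<zero>\<^bsub>N\<^esub>} \<subseteq> carrier N" by simp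
    ultimately show ?thesis using inj_on_image_eq_iff[OF j(2) sub] by (simp only:)
  qed
  moreover have "inj_on i (carrier M)"
  proof (rule inj_onI)
    fix x y assume "x \<in> carrier M" "y \<in> carrier M" "i x = i y"
    moreover from this have "\<iota> x = \<iota> y" using ji by (metis (no_types))
    ultimately show "x = y" using iinj by (simp add: inj_on_def)
  qed
  ultimately show ?thesis using M i by (auto simp: essential_extension_def)
qed

end

theory Submission
  imports Defs "HOL-Algebra.IntRing"
begin

text \<open>
  \<open>J\<close>-injectivity is equivalent to a Baer condition: every homomorphism from a left ideal containing a
  member of \<open>J\<close> to \<open>Q\<close> is right multiplication by an element of \<open>Q\<close>.  Only copies of left ideals of
  \<open>R\<close> are needed to test it, so it does not depend on the type that carries the modules.
  Completeness is likewise a statement about left ideals only.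

  Existence: \<open>M\<close> embeds into a product \<open>E\<close> of copies of the injective module \<open>Hom\<^sub>\<int>(R, \<complex>\<^sup>\<times>)\<close>.  The
  submodule \<open>C = (M :\<^sub>E J)\<close> is a \<open>J\<close>-extension of \<open>M\<close>, and by completeness it still satisfies the Baer
  condition.  A maximal essential extension of \<open>M\<close> inside \<open>C\<close> is a retract of \<open>C\<close>, hence a
  \<open>J\<close>-hull.  The remaining claims follow by extending homomorphisms into the hull, since a homomorphism
  out of an essential extension of \<open>M\<close> is injective as soon as it is injective on \<open>M\<close>.
\<close>

section \<open>Left modules and their submodules\<close>

lemma left_moduleI:
  fixes R (structure) and M (structure)
  assumes "ring R"
    and "\<And>x y. \<lbrakk>x \<in> carrier M; y \<in> carrier M\<rbrakk> \<Longrightarrow> x \<oplus>\<^bsub>M\<^esub> y \<in> carrier M"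
    and "\<zero>\<^bsub>M\<^esub> \<in> carrier M"
    and "\<And>x y z. \<lbrakk>x \<in> carrier M; y \<in> carrier M; z \<in> carrier M\<rbrakk> \<Longrightarrow>
      (x \<oplus>\<^bsub>M\<^esub> y) \<oplus>\<^bsub>M\<^esub> z = x \<oplus>\<^bsub>M\<^esub> (y \<oplus>\<^bsub>M\<^esub> z)"
    and "\<And>x y. \<lbrakk>x \<in> carrier M; y \<in> carrier M\<rbrakk> \<Longrightarrow> x \<oplus>\<^bsub>M\<^esub> y = y \<oplus>\<^bsub>M\<^esub> x"
    and "\<And>x. x \<in> carrier M \<Longrightarrow> \<zero>\<^bsub>M\<^esub> \<oplus>\<^bsub>M\<^esub> x = x"
    and "\<And>x. x \<in> carrier M \<Longrightarrow> \<exists>y\<in>carrier M. y \<oplus>\<^bsub>M\<^esub> x = \<zero>\<^bsub>M\<^esub>"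
    and "\<And>a x. \<lbrakk>a \<in> carrier R; x \<in> carrier M\<rbrakk> \<Longrightarrow> a \<odot>\<^bsub>M\<^esub> x \<in> carrier M"
    and "\<And>a b x. \<lbrakk>a \<in> carrier R; b \<in> carrier R; x \<in> carrier M\<rbrakk> \<Longrightarrow>
        (a \<oplus> b) \<odot>\<^bsub>M\<^esub> x = a \<odot>\<^bsub>M\<^esub> x \<oplus>\<^bsub>M\<^esub> b \<odot>\<^bsub>M\<^esub> x"
    and "\<And>a x y. \<lbrakk>a \<in> carrier R; x \<in> carrier M; y \<in> carrier M\<rbrakk> \<Longrightarrow>
        a \<odot>\<^bsub>M\<^esub> (x \<oplus>\<^bsub>M\<^esub> y) = a \<odot>\<^bsub>M\<^esub> x \<oplus>\<^bsub>M\<^esub> a \<odot>\<^bsub>M\<^esub> y"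
    and "\<And>a b x. \<lbrakk>a \<in> carrier R; b \<in> carrier R; x \<in> carrier M\<rbrakk> \<Longrightarrow>
        (a \<otimes> b) \<odot>\<^bsub>M\<^esub> x = a \<odot>\<^bsub>M\<^esub> (b \<odot>\<^bsub>M\<^esub> x)"
    and "\<And>x. x \<in> carrier M \<Longrightarrow> \<one> \<odot>\<^bsub>M\<^esub> x = x"
  shows "left_module R M"
  unfolding left_module_def left_module_axioms_def
  using assms by (auto intro!: abelian_groupI)

context left_module
begin

lemma smult_r_null [simp]: "a \<in> carrier R \<Longrightarrow> a \<odot>\<^bsub>M\<^esub> \<zero>\<^bsub>M\<^esub> = \<zero>\<^bsub>M\<^esub>"
  by (metis M.add.l_cancel_one' M.zero_closed M.l_zero smult_closed smult_r_distr)

lemma smult_l_null [simp]: "x \<in> carrier M \<Longrightarrow> \<zero> \<odot>\<^bsub>M\<^esub> x = \<zero>\<^bsub>M\<^esub>"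
  by (metis M.add.l_cancel_one' R.zero_closed R.l_zero smult_closed smult_l_distr)

lemma smult_minus_one: "x \<in> carrier M \<Longrightarrow> (\<ominus> \<one>) \<odot>\<^bsub>M\<^esub> x = \<ominus>\<^bsub>M\<^esub> x"
  by (metis M.minus_equality R.add.inv_closed R.l_neg R.one_closed smult_closed smult_l_distr
      smult_l_null smult_one)

text \<open>Closure under negation comes from the action of \<open>\<ominus> \<one>\<close>.\<close>

lemma submoduleI:
  assumes "S \<subseteq> carrier M" "\<zero>\<^bsub>M\<^esub> \<in> S"
    and "\<And>x y. \<lbrakk>x \<in> S; y \<in> S\<rbrakk> \<Longrightarrow> x \<oplus>\<^bsub>M\<^esub> y \<in> S"
    and sm: "\<And>a x. \<lbrakk>a \<in> carrier R; x \<in> S\<rbrakk> \<Longrightarrow> a \<odot>\<^bsub>M\<^esub> x \<in> S"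
  shows "submodule S R M"
proof -
  have "\<ominus>\<^bsub>M\<^esub> x \<in> S" if "x \<in> S" for x
    using sm[of "\<ominus> \<one>" x] that assms(1) by (auto simp: smult_minus_one subset_eq)
  then show ?thesis using assms
    by (auto intro!: submodule.intro subgroup.intro submodule_axioms.intro simp: a_inv_def)
qed

lemma submoduleD:
  assumes "submodule S R M"
  shows "S \<subseteq> carrier M" "\<zero>\<^bsub>M\<^esub> \<in> S"
    "\<And>x y. \<lbrakk>x \<in> S; y \<in> S\<rbrakk> \<Longrightarrow> x \<oplus>\<^bsub>M\<^esub> y \<in> S"
    "\<And>a x. \<lbrakk>a \<in> carrier R; x \<in> S\<rbrakk> \<Longrightarrow> a \<odot>\<^bsub>M\<^esub> x \<in> S"
    "\<And>x. x \<in> S \<Longrightarrow> \<ominus>\<^bsub>M\<^esub> x \<in> S"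
proof -
  interpret submodule S R M by fact
  show "S \<subseteq> carrier M" "\<zero>\<^bsub>M\<^esub> \<in> S"
    "\<And>x y. \<lbrakk>x \<in> S; y \<in> S\<rbrakk> \<Longrightarrow> x \<oplus>\<^bsub>M\<^esub> y \<in> S"
    "\<And>a x. \<lbrakk>a \<in> carrier R; x \<in> S\<rbrakk> \<Longrightarrow> a \<odot>\<^bsub>M\<^esub> x \<in> S"
    "\<And>x. x \<in> S \<Longrightarrow> \<ominus>\<^bsub>M\<^esub> x \<in> S"
    using subset one_closed m_closed m_inv_closed by (auto simp: a_inv_def)
qed

lemma carrier_submodule: "submodule (carrier M) R M"
  by (rule submoduleI) auto

lemma submodule_left_module:
  assumes "submodule S R M"
  shows "left_module R (M\<lparr>carrier := S\<rparr>)"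
proof (rule left_moduleI)
  note D = submoduleD[OF assms]
  note S = subsetD[OF D(1)]
  show "ring R" by (rule R.ring_axioms)
  show "\<exists>y\<in>carrier (M\<lparr>carrier := S\<rparr>). y \<oplus>\<^bsub>M\<lparr>carrier := S\<rparr>\<^esub> x = \<zero>\<^bsub>M\<lparr>carrier := S\<rparr>\<^esub>"
    if "x \<in> carrier (M\<lparr>carrier := S\<rparr>)" for x
    using that D(5)[of x] S by (auto simp: M.l_neg intro!: bexI[of _ "\<ominus>\<^bsub>M\<^esub> x"])
qed (use submoduleD[OF assms] in \<open>auto simp: subset_eq M.a_ac smult_l_distr
      smult_r_distr smult_assoc1\<close>)

lemma submodule_restrict_iff:
  assumes "submodule S R M"
  shows "submodule T R (M\<lparr>carrier := S\<rparr>) \<longleftrightarrow> submodule T R M \<and> T \<subseteq> S"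
proof -
  interpret S: left_module R "M\<lparr>carrier := S\<rparr>" by (rule submodule_left_module[OF assms])
  show ?thesis
  proof safe
    assume T: "submodule T R (M\<lparr>carrier := S\<rparr>)"
    then show "submodule T R M"
      using S.submoduleD[OF T] submoduleD(1)[OF assms] by (intro submoduleI) auto
    show "x \<in> S" if "x \<in> T" for x using S.submoduleD(1)[OF T] that by auto
  next
    assume T: "submodule T R M" "T \<subseteq> S"
    then show "submodule T R (M\<lparr>carrier := S\<rparr>)"
      using submoduleD[OF T(1)] by (intro S.submoduleI) auto
  qed
qed

text \<open>A condition on single elements survives unions of chains. Single-valuedness of graphs,
  trivial intersection and essentiality are all phrased as such a \<open>P\<close> below.\<close>

lemma submodule_Zorn:
  assumes "submodule S\<^sub>0 R M" "\<And>x. x \<in> S\<^sub>0 \<Longrightarrow> P x"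
  obtains S where "submodule S R M" "S\<^sub>0 \<subseteq> S" "\<And>x. x \<in> S \<Longrightarrow> P x"
    "\<And>T. \<lbrakk>submodule T R M; S \<subseteq> T; \<And>x. x \<in> T \<Longrightarrow> P x\<rbrakk> \<Longrightarrow> T = S"
proof -
  let ?A = "{S. submodule S R M \<and> S\<^sub>0 \<subseteq> S \<and> (\<forall>x\<in>S. P x)}"
  have "\<exists>S\<in>?A. \<forall>X\<in>?A. S \<subseteq> X \<longrightarrow> X = S"
  proof (rule subset_Zorn_nonempty)
    show "?A \<noteq> {}" using assms by blast
    fix C assume ne: "C \<noteq> {}" and "subset.chain ?A C"
    then have C: "C \<subseteq> ?A" and ch: "\<And>X Y. X \<in> C \<Longrightarrow> Y \<in> C \<Longrightarrow> X \<subseteq> Y \<or> Y \<subseteq> X"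
      by (auto simp: subset_chain_def)
    have "submodule (\<Union>C) R M"
    proof (rule submoduleI)
      show "\<Union>C \<subseteq> carrier M" using C submoduleD(1) by blast
      show "\<zero>\<^bsub>M\<^esub> \<in> \<Union>C" using C ne submoduleD(2) by blast
      show "a \<odot>\<^bsub>M\<^esub> x \<in> \<Union>C" if "a \<in> carrier R" "x \<in> \<Union>C" for a x
        using C that submoduleD(4) by blast
      show "x \<oplus>\<^bsub>M\<^esub> y \<in> \<Union>C" if xy: "x \<in> \<Union>C" "y \<in> \<Union>C" for x y
      proof -
        obtain X Y where "X \<in> C" "Y \<in> C" "x \<in> X" "y \<in> Y" using xy by blast
        then obtain Z where "Z \<in> C" "x \<in> Z" "y \<in> Z" using ch by blast
        then show ?thesis using C submoduleD(3)[of Z x y] by blast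
      qed
    qed
    then show "\<Union>C \<in> ?A" using C ne by blast
  qed
  then show ?thesis using that by (smt (verit) mem_Collect_eq order_trans)
qed

end

section \<open>Homomorphisms: kernels and preimages\<close>

lemma left_module_homD:
  assumes "f \<in> left_module_hom R A B"
  shows "x \<in> carrier A \<Longrightarrow> f x \<in> carrier B"
    "\<lbrakk>x \<in> carrier A; y \<in> carrier A\<rbrakk> \<Longrightarrow> f (x \<oplus>\<^bsub>A\<^esub> y) = f x \<oplus>\<^bsub>B\<^esub> f y"
    "\<lbrakk>r \<in> carrier R; x \<in> carrier A\<rbrakk> \<Longrightarrow> f (r \<odot>\<^bsub>A\<^esub> x) = r \<odot>\<^bsub>B\<^esub> f x"
  using assms by (auto simp: left_module_hom_def)

lemma left_module_hom_minus:
  assumes A: "left_module R A" and B: "left_module R B" and f: "f \<in> left_module_hom R A B"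
    and x: "x \<in> carrier A"
  shows "f (\<ominus>\<^bsub>A\<^esub> x) = \<ominus>\<^bsub>B\<^esub> f x"
proof -
  interpret A: left_module R A by fact
  interpret B: left_module R B by fact
  note F = left_module_homD[OF f]
  show ?thesis
    using F(3)[of "\<ominus>\<^bsub>R\<^esub> \<one>\<^bsub>R\<^esub>" x] F(1) x by (simp add: A.smult_minus_one B.smult_minus_one)
qed

lemma left_module_hom_inj_iff:
  assumes A: "left_module R A" and B: "left_module R B" and f: "f \<in> left_module_hom R A B"
  shows "inj_on f (carrier A) \<longleftrightarrow> (\<forall>x\<in>carrier A. f x = \<zero>\<^bsub>B\<^esub> \<longrightarrow> x = \<zero>\<^bsub>A\<^esub>)"
proof
  interpret A: left_module R A by fact
  interpret B: left_module R B by fact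
  note F = left_module_homD[OF f] left_module_hom_zero[OF A B f] left_module_hom_minus[OF A B f]
  show "\<forall>x\<in>carrier A. f x = \<zero>\<^bsub>B\<^esub> \<longrightarrow> x = \<zero>\<^bsub>A\<^esub>" if "inj_on f (carrier A)"
    using that F(4) A.M.zero_closed by (metis inj_onD)
  assume *: "\<forall>x\<in>carrier A. f x = \<zero>\<^bsub>B\<^esub> \<longrightarrow> x = \<zero>\<^bsub>A\<^esub>"
  show "inj_on f (carrier A)"
  proof (rule inj_onI)
    fix x y assume xy: "x \<in> carrier A" "y \<in> carrier A" "f x = f y"
    then have "f (x \<oplus>\<^bsub>A\<^esub> \<ominus>\<^bsub>A\<^esub> y) = \<zero>\<^bsub>B\<^esub>" using F(1,2,5) by (simp add: B.M.r_neg)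
    then have "x \<oplus>\<^bsub>A\<^esub> \<ominus>\<^bsub>A\<^esub> y = \<zero>\<^bsub>A\<^esub>" using * xy by simp
    then show "x = y" using xy by (metis A.M.minus_equality A.M.minus_minus A.M.add.inv_closed)
  qed
qed

lemma left_module_hom_vimage_submodule:
  assumes A: "left_module R A" and B: "left_module R B" and f: "f \<in> left_module_hom R A B"
    and S: "submodule S R B"
  shows "submodule {x \<in> carrier A. f x \<in> S} R A"
proof -
  interpret A: left_module R A by fact
  interpret B: left_module R B by fact
  show ?thesis
    using left_module_homD[OF f] left_module_hom_zero[OF A B f] B.submoduleD[OF S]
    by (intro A.submoduleI) auto
qed

section \<open>The ring as a left module over itself, and binary products\<close>

definition regular_module :: "('r, 'c) ring_scheme \<Rightarrow> ('r, 'r) module"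
  where "regular_module R = \<lparr>carrier = carrier R, monoid.mult = (\<otimes>\<^bsub>R\<^esub>), one = \<one>\<^bsub>R\<^esub>,
    zero = \<zero>\<^bsub>R\<^esub>, add = (\<oplus>\<^bsub>R\<^esub>), smult = (\<otimes>\<^bsub>R\<^esub>)\<rparr>"

lemma regular_module_simps [simp]:
  "carrier (regular_module R) = carrier R" "\<zero>\<^bsub>regular_module R\<^esub> = \<zero>\<^bsub>R\<^esub>"
  "x \<oplus>\<^bsub>regular_module R\<^esub> y = x \<oplus>\<^bsub>R\<^esub> y" "x \<odot>\<^bsub>regular_module R\<^esub> y = x \<otimes>\<^bsub>R\<^esub> y"
  by (simp_all add: regular_module_def)

lemma left_module_regular_module:
  assumes "ring R"
  shows "left_module R (regular_module R)"
proof -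
  interpret ring R by fact
  show ?thesis
    by (rule left_moduleI)
      (auto simp: assms a_ac m_assoc l_distr r_distr intro: bexI[of _ "\<ominus>\<^bsub>R\<^esub> _"] l_neg)
qed

text \<open>Partial homomorphisms are handled as submodules of this product, namely as their
  graphs.\<close>

definition prod_module ::
    "('r, 'a, 'd) module_scheme \<Rightarrow> ('r, 'b, 'e) module_scheme \<Rightarrow> ('r, 'a \<times> 'b) module"
  where "prod_module A B = \<lparr>carrier = carrier A \<times> carrier B, monoid.mult = (\<lambda>x y. x),
    one = (\<zero>\<^bsub>A\<^esub>, \<zero>\<^bsub>B\<^esub>), zero = (\<zero>\<^bsub>A\<^esub>, \<zero>\<^bsub>B\<^esub>),
    add = (\<lambda>x y. (fst x \<oplus>\<^bsub>A\<^esub> fst y, snd x \<oplus>\<^bsub>B\<^esub> snd y)),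
    smult = (\<lambda>r x. (r \<odot>\<^bsub>A\<^esub> fst x, r \<odot>\<^bsub>B\<^esub> snd x))\<rparr>"

lemma prod_module_simps [simp]:
  "carrier (prod_module A B) = carrier A \<times> carrier B"
  "\<zero>\<^bsub>prod_module A B\<^esub> = (\<zero>\<^bsub>A\<^esub>, \<zero>\<^bsub>B\<^esub>)"
  "x \<oplus>\<^bsub>prod_module A B\<^esub> y = (fst x \<oplus>\<^bsub>A\<^esub> fst y, snd x \<oplus>\<^bsub>B\<^esub> snd y)"
  "r \<odot>\<^bsub>prod_module A B\<^esub> x = (r \<odot>\<^bsub>A\<^esub> fst x, r \<odot>\<^bsub>B\<^esub> snd x)"
  by (simp_all add: prod_module_def)

lemma left_module_prod_module:
  assumes "left_module R A" "left_module R B"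
  shows "left_module R (prod_module A B)"
proof -
  interpret A: left_module R A by fact
  interpret B: left_module R B by fact
  show ?thesis
  proof (rule left_moduleI)
    show "ring R" by (rule A.R.ring_axioms)
    fix x assume "x \<in> carrier (prod_module A B)"
    then show "\<exists>y\<in>carrier (prod_module A B). y \<oplus>\<^bsub>prod_module A B\<^esub> x = \<zero>\<^bsub>prod_module A B\<^esub>"
      by (intro bexI[of _ "(\<ominus>\<^bsub>A\<^esub> fst x, \<ominus>\<^bsub>B\<^esub> snd x)"]) (auto simp: A.M.l_neg B.M.l_neg)
  qed (auto simp: A.M.a_ac A.smult_l_distr A.smult_r_distr A.smult_assoc1
        B.M.a_ac B.smult_l_distr B.smult_r_distr B.smult_assoc1)
qed

section \<open>A Baer criterion\<close>

text \<open>For an ideal filter \<open>J\<close>, the left ideals \<open>L\<close> containing some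
  \<open>I \<in> J\<close> are those whose inclusion into \<open>R\<close> is a
  \<open>J\<close>-extension: \<open>I\<close> is a right ideal, so \<open>I r \<subseteq> L\<close>
  for every \<open>r\<close>.\<close>

definition baer :: "('r, 'c) ring_scheme \<Rightarrow> 'r set set \<Rightarrow> ('r, 'q, 'd) module_scheme \<Rightarrow> bool"
  where "baer R J Q \<longleftrightarrow> left_module R Q \<and>
    (\<forall>L f. submodule L R (regular_module R) \<and> (\<exists>I\<in>J. I \<subseteq> L) \<and>
       f \<in> left_module_hom R (regular_module R\<lparr>carrier := L\<rparr>) Q \<longrightarrow>
       (\<exists>q\<in>carrier Q. \<forall>r\<in>L. f r = r \<odot>\<^bsub>Q\<^esub> q))"

text \<open>The partial homomorphism to be extended is given by its graph \<open>G\<^sub>0\<close>, which makes it a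
  submodule of the product and gives Zorn's lemma an elementwise condition.\<close>

lemma baer_extend:
  assumes Q: "baer R J Q" and B: "left_module R B"
    and G0: "submodule G\<^sub>0 R (prod_module B Q)"
    and single: "\<And>y. (\<zero>\<^bsub>B\<^esub>, y) \<in> G\<^sub>0 \<Longrightarrow> y = \<zero>\<^bsub>Q\<^esub>"
    and dense: "\<And>x. x \<in> carrier B \<Longrightarrow> \<exists>I\<in>J. \<forall>a\<in>I. a \<in> carrier R \<and> a \<odot>\<^bsub>B\<^esub> x \<in> fst ` G\<^sub>0"
  obtains g where "g \<in> left_module_hom R B Q" "\<And>x y. (x, y) \<in> G\<^sub>0 \<Longrightarrow> g x = y"
proof -
  have Qm: "left_module R Q" using Q by (simp add: baer_def)
  interpret B: left_module R B by fact
  interpret Q: left_module R Q by fact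
  interpret P: left_module R "prod_module B Q" by (rule left_module_prod_module[OF B Qm])
  interpret RR: left_module R "regular_module R"
    by (rule left_module_regular_module) (rule B.R.ring_axioms)
  \<comment> \<open>A graph that is a submodule is single-valued as soon as its fibre over zero is
    trivial, and this constrains single elements only.\<close>
  obtain G where G: "submodule G R (prod_module B Q)" "G\<^sub>0 \<subseteq> G"
    and G0z: "\<And>p. p \<in> G \<Longrightarrow> fst p = \<zero>\<^bsub>B\<^esub> \<longrightarrow> snd p = \<zero>\<^bsub>Q\<^esub>"
    and Gmax: "\<And>T. \<lbrakk>submodule T R (prod_module B Q); G \<subseteq> T;
        \<And>p. p \<in> T \<Longrightarrow> fst p = \<zero>\<^bsub>B\<^esub> \<longrightarrow> snd p = \<zero>\<^bsub>Q\<^esub>\<rbrakk> \<Longrightarrow> T = G"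
    by (rule P.submodule_Zorn[OF G0, where P = "\<lambda>p. fst p = \<zero>\<^bsub>B\<^esub> \<longrightarrow> snd p = \<zero>\<^bsub>Q\<^esub>"])
      (use single in auto)
  note D = P.submoduleD[OF G(1)]
  have Gadd: "(x \<oplus>\<^bsub>B\<^esub> x', y \<oplus>\<^bsub>Q\<^esub> y') \<in> G" if "(x, y) \<in> G" "(x', y') \<in> G" for x x' y y'
    using D(3)[OF that] by simp
  have Gsm: "(a \<odot>\<^bsub>B\<^esub> x, a \<odot>\<^bsub>Q\<^esub> y) \<in> G" if "a \<in> carrier R" "(x, y) \<in> G" for a x y
    using D(4)[OF that] by simp
  have Gc: "x \<in> carrier B" "y \<in> carrier Q" if "(x, y) \<in> G" for x y using D(1) that by auto
  have uniq: "y = y'" if "(x, y) \<in> G" "(x, y') \<in> G" for x y y'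
  proof -
    have "(x \<oplus>\<^bsub>B\<^esub> (\<ominus>\<^bsub>R\<^esub> \<one>\<^bsub>R\<^esub>) \<odot>\<^bsub>B\<^esub> x, y \<oplus>\<^bsub>Q\<^esub> (\<ominus>\<^bsub>R\<^esub> \<one>\<^bsub>R\<^esub>) \<odot>\<^bsub>Q\<^esub> y') \<in> G"
      using that by (intro Gadd Gsm) auto
    then have "y \<oplus>\<^bsub>Q\<^esub> \<ominus>\<^bsub>Q\<^esub> y' = \<zero>\<^bsub>Q\<^esub>"
      using G0z[of "(_, _)"] Gc that by (simp add: B.smult_minus_one Q.smult_minus_one B.M.r_neg)
    then show ?thesis using Gc that
      by (metis Q.M.minus_equality Q.M.minus_minus Q.M.add.inv_closed)
  qed
  have total: "\<exists>y. (x, y) \<in> G" if x: "x \<in> carrier B" for x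
  proof -
    \<comment> \<open>\<open>L\<close> collects the scalars that move \<open>x\<close> into the
      domain of \<open>G\<close>, and \<open>f\<close> sends \<open>r\<close> to the value of
      \<open>G\<close> at \<open>r x\<close>. The Baer condition turns \<open>f\<close> into
      multiplication by some \<open>q\<close>, the value to be assigned to \<open>x\<close>.\<close>
    define L where "L = {r \<in> carrier R. \<exists>y. (r \<odot>\<^bsub>B\<^esub> x, y) \<in> G}"
    define f where "f r = (THE y. (r \<odot>\<^bsub>B\<^esub> x, y) \<in> G)" for r
    have f: "f r = y" if "(r \<odot>\<^bsub>B\<^esub> x, y) \<in> G" for r y
      unfolding f_def using that uniq by blast
    have fG: "(r \<odot>\<^bsub>B\<^esub> x, f r) \<in> G" if "r \<in> L" for r
      using that f unfolding L_def by blast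
    have sG: "((r \<oplus>\<^bsub>R\<^esub> s) \<odot>\<^bsub>B\<^esub> x, f r \<oplus>\<^bsub>Q\<^esub> f s) \<in> G" if "r \<in> L" "s \<in> L" for r s
      using Gadd[OF fG[OF that(1)] fG[OF that(2)]] that x by (simp add: L_def B.smult_l_distr)
    have mG: "((r \<otimes>\<^bsub>R\<^esub> s) \<odot>\<^bsub>B\<^esub> x, r \<odot>\<^bsub>Q\<^esub> f s) \<in> G" if "r \<in> carrier R" "s \<in> L" for r s
      using Gsm[OF that(1) fG[OF that(2)]] that x by (simp add: L_def B.smult_assoc1)
    have "submodule L R (regular_module R)"
    proof (rule RR.submoduleI)
      show "\<zero>\<^bsub>regular_module R\<^esub> \<in> L" using D(2) x by (auto simp: L_def)
      show "r \<oplus>\<^bsub>regular_module R\<^esub> s \<in> L" if "r \<in> L" "s \<in> L" for r s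
        using sG[OF that] that by (auto simp: L_def)
      show "r \<odot>\<^bsub>regular_module R\<^esub> s \<in> L" if "r \<in> carrier R" "s \<in> L" for r s
        using mG[OF that] that by (auto simp: L_def)
    qed (auto simp: L_def)
    moreover have "\<exists>I\<in>J. I \<subseteq> L"
    proof -
      obtain I where I: "I \<in> J" "\<forall>a\<in>I. a \<in> carrier R \<and> a \<odot>\<^bsub>B\<^esub> x \<in> fst ` G\<^sub>0"
        using dense[OF x] by blast
      then have "I \<subseteq> L" using G(2) unfolding L_def by force
      then show ?thesis using I by blast
    qed
    moreover have "f \<in> left_module_hom R (regular_module R\<lparr>carrier := L\<rparr>) Q"
      using fG Gc(2) f[OF sG] f[OF mG] by (auto simp: left_module_hom_def)
    ultimately obtain q where q: "q \<in> carrier Q" "\<And>r. r \<in> L \<Longrightarrow> f r = r \<odot>\<^bsub>Q\<^esub> q"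
      using Q unfolding baer_def by blast
    \<comment> \<open>The graph \<open>G + R (x, q)\<close>; maximality of \<open>G\<close> will
      force \<open>(x, q) \<in> G\<close>.\<close>
    define T where "T = {(a \<oplus>\<^bsub>B\<^esub> r \<odot>\<^bsub>B\<^esub> x, b \<oplus>\<^bsub>Q\<^esub> r \<odot>\<^bsub>Q\<^esub> q) |a b r. (a, b) \<in> G \<and> r \<in> carrier R}"
    have TI: "(a \<oplus>\<^bsub>B\<^esub> r \<odot>\<^bsub>B\<^esub> x, b \<oplus>\<^bsub>Q\<^esub> r \<odot>\<^bsub>Q\<^esub> q) \<in> T" if "(a, b) \<in> G" "r \<in> carrier R" for a b r
      using that unfolding T_def by blast
    have z: "(\<zero>\<^bsub>B\<^esub>, \<zero>\<^bsub>Q\<^esub>) \<in> G" using D(2) by simp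
    have "submodule T R (prod_module B Q)"
    proof (rule P.submoduleI)
      show "T \<subseteq> carrier (prod_module B Q)" unfolding T_def using Gc x q by auto
      show "\<zero>\<^bsub>prod_module B Q\<^esub> \<in> T" using TI[OF z B.R.zero_closed] x q by simp
    next
      fix p p' assume "p \<in> T" "p' \<in> T"
      then obtain a b r a' b' r' where
        p: "p = (a \<oplus>\<^bsub>B\<^esub> r \<odot>\<^bsub>B\<^esub> x, b \<oplus>\<^bsub>Q\<^esub> r \<odot>\<^bsub>Q\<^esub> q)" "(a, b) \<in> G" "r \<in> carrier R" and
        p': "p' = (a' \<oplus>\<^bsub>B\<^esub> r' \<odot>\<^bsub>B\<^esub> x, b' \<oplus>\<^bsub>Q\<^esub> r' \<odot>\<^bsub>Q\<^esub> q)" "(a', b') \<in> G" "r' \<in> carrier R"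
        unfolding T_def by blast
      have "p \<oplus>\<^bsub>prod_module B Q\<^esub> p' =
          ((a \<oplus>\<^bsub>B\<^esub> a') \<oplus>\<^bsub>B\<^esub> (r \<oplus>\<^bsub>R\<^esub> r') \<odot>\<^bsub>B\<^esub> x, (b \<oplus>\<^bsub>Q\<^esub> b') \<oplus>\<^bsub>Q\<^esub> (r \<oplus>\<^bsub>R\<^esub> r') \<odot>\<^bsub>Q\<^esub> q)"
        using p p' Gc[OF p(2)] Gc[OF p'(2)] x q
        by (simp add: B.smult_l_distr Q.smult_l_distr B.M.a_ac Q.M.a_ac)
      then show "p \<oplus>\<^bsub>prod_module B Q\<^esub> p' \<in> T" using TI Gadd[OF p(2) p'(2)] p p' by simp
    next
      fix s p assume s: "s \<in> carrier R" and "p \<in> T"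
      then obtain a b r where
        p: "p = (a \<oplus>\<^bsub>B\<^esub> r \<odot>\<^bsub>B\<^esub> x, b \<oplus>\<^bsub>Q\<^esub> r \<odot>\<^bsub>Q\<^esub> q)" "(a, b) \<in> G" "r \<in> carrier R"
        unfolding T_def by blast
      have "s \<odot>\<^bsub>prod_module B Q\<^esub> p =
          (s \<odot>\<^bsub>B\<^esub> a \<oplus>\<^bsub>B\<^esub> (s \<otimes>\<^bsub>R\<^esub> r) \<odot>\<^bsub>B\<^esub> x, s \<odot>\<^bsub>Q\<^esub> b \<oplus>\<^bsub>Q\<^esub> (s \<otimes>\<^bsub>R\<^esub> r) \<odot>\<^bsub>Q\<^esub> q)"
        using p Gc[OF p(2)] x q s
        by (simp add: B.smult_r_distr Q.smult_r_distr B.smult_assoc1 Q.smult_assoc1)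
      then show "s \<odot>\<^bsub>prod_module B Q\<^esub> p \<in> T" using TI Gsm[OF s p(2)] p s by simp
    qed
    moreover have "G \<subseteq> T"
    proof
      fix p assume "p \<in> G"
      then obtain a b where p: "p = (a, b)" "(a, b) \<in> G" by (cases p) auto
      then show "p \<in> T" using TI[OF p(2) B.R.zero_closed] Gc[OF p(2)] x q by simp
    qed
    moreover have "fst p = \<zero>\<^bsub>B\<^esub> \<longrightarrow> snd p = \<zero>\<^bsub>Q\<^esub>" if pT: "p \<in> T" for p
    proof
      assume f0: "fst p = \<zero>\<^bsub>B\<^esub>"
      obtain a b r where
        p: "p = (a \<oplus>\<^bsub>B\<^esub> r \<odot>\<^bsub>B\<^esub> x, b \<oplus>\<^bsub>Q\<^esub> r \<odot>\<^bsub>Q\<^esub> q)" "(a, b) \<in> G" "r \<in> carrier R"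
        using pT unfolding T_def by blast
      \<comment> \<open>Well-definedness: from \<open>a + r x = 0\<close> the scalar
        \<open>r\<close> lies in \<open>L\<close>, where \<open>f r\<close> is both
        \<open>r q\<close> and \<open>- b\<close>.\<close>
      have "r \<odot>\<^bsub>B\<^esub> x = \<ominus>\<^bsub>B\<^esub> a"
        using f0 p Gc[OF p(2)] x by (metis B.M.a_comm B.M.minus_equality B.smult_closed fst_conv)
      then have "(r \<odot>\<^bsub>B\<^esub> x, \<ominus>\<^bsub>Q\<^esub> b) \<in> G"
        using Gsm[OF _ p(2), of "\<ominus>\<^bsub>R\<^esub> \<one>\<^bsub>R\<^esub>"] Gc[OF p(2)]
        by (simp add: B.smult_minus_one Q.smult_minus_one)
      moreover from this have "r \<in> L" using p(3) unfolding L_def by blast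
      ultimately have "r \<odot>\<^bsub>Q\<^esub> q = \<ominus>\<^bsub>Q\<^esub> b" using f q(2) by metis
      then show "snd p = \<zero>\<^bsub>Q\<^esub>" using p Gc[OF p(2)] by (simp add: Q.M.r_neg)
    qed
    ultimately have "T = G" by (rule Gmax)
    then have "(x, q) \<in> G" using TI[OF z B.R.one_closed] x q by simp
    then show ?thesis by blast
  qed
  define g where "g x = (THE y. (x, y) \<in> G)" for x
  have gI: "g x = y" if "(x, y) \<in> G" for x y
    unfolding g_def using that uniq by blast
  have gG: "(x, g x) \<in> G" if "x \<in> carrier B" for x
    using total[OF that] gI by blast
  have "g \<in> left_module_hom R B Q"
    using gG Gc(2) gI[OF Gadd[OF gG gG]] gI[OF Gsm[OF _ gG]]
    by (auto simp: left_module_hom_def)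
  moreover have "g x = y" if "(x, y) \<in> G\<^sub>0" for x y using gI G(2) that by blast
  ultimately show ?thesis by (rule that)
qed

section \<open>From the Baer condition to \<open>J\<close>-injectivity\<close>

lemma ideal_filterD:
  assumes "ideal_filter R J"
  shows "I \<in> J \<Longrightarrow> I \<subseteq> carrier R" "\<lbrakk>I \<in> J; a \<in> I; r \<in> carrier R\<rbrakk> \<Longrightarrow> a \<otimes>\<^bsub>R\<^esub> r \<in> I"
    "\<lbrakk>I \<in> J; I' \<in> J\<rbrakk> \<Longrightarrow> I \<inter> I' \<in> J" "J \<noteq> {}"
proof -
  have r: "right_ideal I R" if "I \<in> J" for I using assms that unfolding ideal_filter_def by blast
  show "I \<in> J \<Longrightarrow> I \<subseteq> carrier R"
    using additive_subgroup.a_subset r[of I] unfolding right_ideal_def by blast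
  show "\<lbrakk>I \<in> J; a \<in> I; r \<in> carrier R\<rbrakk> \<Longrightarrow> a \<otimes>\<^bsub>R\<^esub> r \<in> I"
    using r[of I] unfolding right_ideal_def by blast
  show "\<lbrakk>I \<in> J; I' \<in> J\<rbrakk> \<Longrightarrow> I \<inter> I' \<in> J" "J \<noteq> {}"
    using assms unfolding ideal_filter_def by blast+
qed

text \<open>The graph to extend consists of the pairs \<open>(i x, f x)\<close>: injectivity of
  \<open>i\<close> makes it single-valued, and the \<open>J\<close>-extension property is the
  density that \<open>baer_extend\<close> demands. \<open>A\<close> and \<open>B\<close> may live on
  any types, which frees later arguments from the test type \<open>'u\<close>.\<close>

lemma baer_J_extension:
  assumes Q: "baer R J Q" and J: "ideal_filter R J" and ext: "J_extension R J A B i"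
    and f: "f \<in> left_module_hom R A Q"
  obtains g where "g \<in> left_module_hom R B Q" "\<And>x. x \<in> carrier A \<Longrightarrow> g (i x) = f x"
proof -
  have A: "left_module R A" and B: "left_module R B" and i: "i \<in> left_module_hom R A B"
    and inj: "inj_on i (carrier A)" and col: "filter_colon (i ` carrier A) B J = carrier B"
    using ext by (auto simp: J_extension_def)
  have Qm: "left_module R Q" using Q by (simp add: baer_def)
  interpret A: left_module R A by fact
  note JR = ideal_filterD(1)[OF J]
  let ?h = "\<lambda>x. (i x, f x)"
  have "?h \<in> left_module_hom R A (prod_module B Q)"
    using left_module_homD[OF i] left_module_homD[OF f] by (auto simp: left_module_hom_def)
  then have G0: "submodule (?h ` carrier A) R (prod_module B Q)"
    by (rule left_module_hom_image_submodule[OF A left_module_prod_module[OF B Qm] _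
          A.carrier_submodule])
  obtain g where "g \<in> left_module_hom R B Q" "\<And>x y. (x, y) \<in> ?h ` carrier A \<Longrightarrow> g x = y"
  proof (rule baer_extend[OF Q B G0])
    show "y = \<zero>\<^bsub>Q\<^esub>" if "(\<zero>\<^bsub>B\<^esub>, y) \<in> ?h ` carrier A" for y
      using that inj left_module_hom_inj_iff[OF A B i] left_module_hom_zero[OF A Qm f] by auto
    show "\<exists>I\<in>J. \<forall>a\<in>I. a \<in> carrier R \<and> a \<odot>\<^bsub>B\<^esub> x \<in> fst ` ?h ` carrier A" if "x \<in> carrier B" for x
    proof -
      have "x \<in> filter_colon (i ` carrier A) B J" using col that by simp
      then obtain I where "I \<in> J" "\<forall>a\<in>I. a \<odot>\<^bsub>B\<^esub> x \<in> i ` carrier A"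
        by (auto simp: filter_colon_def)
      then show ?thesis using JR by (auto simp: image_image intro!: bexI[of _ I])
    qed
  qed blast
  then show ?thesis using that by blast
qed

lemma baer_imp_J_injective:
  fixes U :: "'u itself" and R :: "('r, 'c) ring_scheme"
  assumes "baer R J Q" "ideal_filter R J"
  shows "J_injective U R J Q"
  unfolding J_injective_def
proof safe
  show "left_module R Q" using assms(1) by (simp add: baer_def)
  fix A B :: "('r, 'u) module" and i f
  assume "J_extension R J A B i" "f \<in> left_module_hom R A Q"
  then show "\<exists>g\<in>left_module_hom R B Q. \<forall>x\<in>carrier A. g (i x) = f x"
    by (rule baer_J_extension[OF assms]) blast
qed

text \<open>Copies of modules carried by \<^typ>\<open>'a\<close> on the larger type \<^typ>\<open>'a + 'u\<close>; they
  make the quantification over modules on \<^typ>\<open>'r + 'u\<close> reach the left ideals of the ring.\<close>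

definition Inl_module :: "('r, 'a, 'd) module_scheme \<Rightarrow> ('r, 'a + 'u) module"
  where "Inl_module A = \<lparr>carrier = Inl ` carrier A, monoid.mult = (\<lambda>x y. x),
    one = Inl \<zero>\<^bsub>A\<^esub>, zero = Inl \<zero>\<^bsub>A\<^esub>, add = (\<lambda>x y. Inl (projl x \<oplus>\<^bsub>A\<^esub> projl y)),
    smult = (\<lambda>r x. Inl (r \<odot>\<^bsub>A\<^esub> projl x))\<rparr>"

lemma Inl_module_simps [simp]:
  "carrier (Inl_module A) = Inl ` carrier A" "\<zero>\<^bsub>Inl_module A\<^esub> = Inl \<zero>\<^bsub>A\<^esub>"
  "x \<oplus>\<^bsub>Inl_module A\<^esub> y = Inl (projl x \<oplus>\<^bsub>A\<^esub> projl y)"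
  "r \<odot>\<^bsub>Inl_module A\<^esub> x = Inl (r \<odot>\<^bsub>A\<^esub> projl x)"
  by (simp_all add: Inl_module_def)

lemma left_module_Inl_module:
  assumes "left_module R A"
  shows "left_module R (Inl_module A)"
proof -
  interpret A: left_module R A by fact
  show ?thesis
  proof (rule left_moduleI)
    show "ring R" by (rule A.R.ring_axioms)
    show "\<exists>y\<in>carrier (Inl_module A). y \<oplus>\<^bsub>Inl_module A\<^esub> x = \<zero>\<^bsub>Inl_module A\<^esub>"
      if "x \<in> carrier (Inl_module A)" for x
      using that by (intro bexI[of _ "Inl (\<ominus>\<^bsub>A\<^esub> projl x)"]) (auto simp: A.M.l_neg)
  qed (auto simp: A.M.a_ac A.smult_l_distr A.smult_r_distr A.smult_assoc1)
qed

lemma Inl_hom: "Inl \<in> left_module_hom R A (Inl_module A)"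
  by (auto simp: left_module_hom_def)

lemma hom_comp_projl:
  "f \<in> left_module_hom R A B \<Longrightarrow> f \<circ> projl \<in> left_module_hom R (Inl_module A) B"
  by (auto simp: left_module_hom_def)

section \<open>Left ideal forms of \<open>J\<close>-injectivity and completeness\<close>

text \<open>Test \<open>Q\<close> against the inclusion of \<open>L\<close> into \<open>R\<close>,
  copied to \<open>'r + 'u\<close>; the multiplier \<open>q\<close> is the image of
  \<open>\<one>\<close> under the extension of \<open>f\<close>.\<close>

lemma J_injective_imp_baer:
  fixes R :: "('r, 'c) ring_scheme"
  assumes R: "ring R" and J: "ideal_filter R J" and Q: "J_injective TYPE('r + 'u) R J Q"
  shows "baer R J Q"
  unfolding baer_def
proof (intro conjI allI impI; (elim conjE)?)
  show "left_module R Q" using Q by (simp add: J_injective_def)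
  fix L f assume L: "submodule L R (regular_module R)" and "\<exists>I\<in>J. I \<subseteq> L"
    and f: "f \<in> left_module_hom R (regular_module R\<lparr>carrier := L\<rparr>) Q"
  then obtain I where I: "I \<in> J" "I \<subseteq> L" by blast
  note ri = ideal_filterD(2)[OF J I(1)]
  interpret RR: left_module R "regular_module R" by (rule left_module_regular_module[OF R])
  let ?A = "Inl_module (regular_module R\<lparr>carrier := L\<rparr>) :: ('r, 'r + 'u) module"
  let ?B = "Inl_module (regular_module R) :: ('r, 'r + 'u) module"
  note D = RR.submoduleD[OF L]
  have "J_extension R J ?A ?B id"
    unfolding J_extension_def
  proof (intro conjI)
    show "left_module R ?A"
      by (rule left_module_Inl_module) (rule RR.submodule_left_module[OF L])
    show "left_module R ?B" by (rule left_module_Inl_module) (rule RR.left_module_axioms)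
    show "id \<in> left_module_hom R ?A ?B"
      using D by (auto simp: left_module_hom_def)
    show "filter_colon (id ` carrier ?A) ?B J = carrier ?B"
    proof
      show "carrier ?B \<subseteq> filter_colon (id ` carrier ?A) ?B J"
      proof
        fix x assume x: "x \<in> carrier ?B"
        then obtain r where r: "x = Inl r" "r \<in> carrier R" by auto
        \<comment> \<open>\<open>I\<close> is a right ideal, so
          \<open>a r \<in> I \<subseteq> L\<close>: the same \<open>I\<close> serves every
          \<open>r\<close>.\<close>
        have "a \<odot>\<^bsub>?B\<^esub> x \<in> id ` carrier ?A" if "a \<in> I" for a
          using subsetD[OF I(2) ri[OF that r(2)]] r(1) by simp
        then show "x \<in> filter_colon (id ` carrier ?A) ?B J"
          using x I(1) unfolding filter_colon_def by blast
      qed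
    qed (auto simp: filter_colon_def)
  qed simp
  then have "\<exists>g\<in>left_module_hom R ?B Q. \<forall>x\<in>carrier ?A. g (id x) = (f \<circ> projl) x"
    using Q hom_comp_projl[OF f] unfolding J_injective_def by blast
  then obtain g where g: "g \<in> left_module_hom R ?B Q" "\<And>r. r \<in> L \<Longrightarrow> g (Inl r) = f r"
    by auto
  show "\<exists>q\<in>carrier Q. \<forall>r\<in>L. f r = r \<odot>\<^bsub>Q\<^esub> q"
  proof (intro bexI ballI)
    show "g (Inl \<one>\<^bsub>R\<^esub>) \<in> carrier Q" using left_module_homD(1)[OF g(1)] by simp
    fix r assume r: "r \<in> L"
    then have rc: "r \<in> carrier R" using D(1) by auto
    then show "f r = r \<odot>\<^bsub>Q\<^esub> g (Inl \<one>\<^bsub>R\<^esub>)"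
      using left_module_homD(3)[OF g(1), of r "Inl \<one>\<^bsub>R\<^esub>"] g(2)[OF r] by simp
  qed
qed

text \<open>Completeness for \<open>L \<subseteq> R\<close>, read at the element
  \<open>\<one>\<close>: the hypothesis puts \<open>I \<one>\<close> into \<open>(L : J)\<close>, so
  \<open>\<one>\<close> lies in \<open>((L : J) : J) = (L : J)\<close>, and \<open>K\<close> is a
  witness of this.\<close>

lemma complete_filter_left_ideal:
  fixes R :: "('r, 'c) ring_scheme"
  assumes R: "ring R" and J: "ideal_filter R J" and comp: "complete_filter TYPE('r + 'u) R J"
    and L: "submodule L R (regular_module R)"
    and I: "I \<in> J" "\<And>a. a \<in> I \<Longrightarrow> \<exists>K\<in>J. \<forall>b\<in>K. b \<otimes>\<^bsub>R\<^esub> a \<in> L"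
  obtains K where "K \<in> J" "K \<subseteq> L"
proof -
  interpret RR: left_module R "regular_module R" by (rule left_module_regular_module[OF R])
  let ?B = "Inl_module (regular_module R) :: ('r, 'r + 'u) module"
  note JR = ideal_filterD(1)[OF J]
  have B: "left_module R ?B" by (rule left_module_Inl_module) (rule RR.left_module_axioms)
  have "submodule (Inl ` L) R ?B"
    by (rule left_module_hom_image_submodule[OF RR.left_module_axioms B Inl_hom L])
  then have eq: "filter_colon (filter_colon (Inl ` L) ?B J) ?B J = filter_colon (Inl ` L) ?B J"
    using comp B unfolding complete_filter_def by blast
  have mem: "Inl x \<in> filter_colon S ?B J \<longleftrightarrow> (\<exists>K\<in>J. \<forall>b\<in>K. Inl (b \<otimes>\<^bsub>R\<^esub> x) \<in> S)"
    if "x \<in> carrier R" for x S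
    using that by (simp add: filter_colon_def image_iff)
  have one: "a \<otimes>\<^bsub>R\<^esub> \<one>\<^bsub>R\<^esub> = a" if "a \<in> K" "K \<in> J" for a K
    using JR[OF that(2)] that(1) by auto
  have "Inl (a \<otimes>\<^bsub>R\<^esub> \<one>\<^bsub>R\<^esub>) \<in> filter_colon (Inl ` L) ?B J" if "a \<in> I" for a
  proof -
    have "a \<in> carrier R" using JR[OF I(1)] that by blast
    from mem[OF this, of "Inl ` L"] show ?thesis
      unfolding one[OF that I(1)] using I(2)[OF that] by blast
  qed
  then have "Inl \<one>\<^bsub>R\<^esub> \<in> filter_colon (filter_colon (Inl ` L) ?B J) ?B J"
    unfolding mem[OF RR.R.one_closed] using I(1) by blast
  then obtain K where K: "K \<in> J" "\<And>a. a \<in> K \<Longrightarrow> Inl (a \<otimes>\<^bsub>R\<^esub> \<one>\<^bsub>R\<^esub>) \<in> Inl ` L"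
    unfolding eq mem[OF RR.R.one_closed] by blast
  have "K \<subseteq> L"
  proof
    fix a assume "a \<in> K"
    from K(2)[OF this] show "a \<in> L" unfolding one[OF \<open>a \<in> K\<close> K(1)] by blast
  qed
  with K(1) show ?thesis by (rule that)
qed

section \<open>Hulls and extensions\<close>

text \<open>The kernel of \<open>j\<close> meets \<open>i(M)\<close> only in zero, so essentiality
  makes it zero.\<close>

lemma essential_hom_inj:
  assumes ess: "essential_extension R M N i" and Q: "left_module R Q"
    and j: "j \<in> left_module_hom R N Q"
    and z: "\<And>x. \<lbrakk>x \<in> carrier M; j (i x) = \<zero>\<^bsub>Q\<^esub>\<rbrakk> \<Longrightarrow> x = \<zero>\<^bsub>M\<^esub>"
  shows "inj_on j (carrier N)"
proof -
  have M: "left_module R M" and N: "left_module R N" and i: "i \<in> left_module_hom R M N"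
    using ess by (auto simp: essential_extension_def)
  interpret M: left_module R M by fact
  interpret N: left_module R N by fact
  interpret Q: left_module R Q by fact
  let ?K = "{x \<in> carrier N. j x \<in> {\<zero>\<^bsub>Q\<^esub>}}"
  have "submodule {\<zero>\<^bsub>Q\<^esub>} R Q" by (rule Q.submoduleI) auto
  then have K: "submodule ?K R N" by (rule left_module_hom_vimage_submodule[OF N Q j])
  have "?K \<inter> i ` carrier M = {\<zero>\<^bsub>N\<^esub>}"
  proof
    show "?K \<inter> i ` carrier M \<subseteq> {\<zero>\<^bsub>N\<^esub>}"
      using z left_module_hom_zero[OF M N i] by auto
    show "{\<zero>\<^bsub>N\<^esub>} \<subseteq> ?K \<inter> i ` carrier M"
      using left_module_hom_zero[OF M N i] left_module_hom_zero[OF N Q j]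
        imageI[OF M.M.zero_closed, of i] by simp
  qed
  then have "?K = {\<zero>\<^bsub>N\<^esub>}" using ess K by (auto simp: essential_extension_def)
  then show ?thesis unfolding left_module_hom_inj_iff[OF N Q j] by blast
qed

lemma filter_colon_mono:
  assumes "A \<subseteq> A'"
  shows "filter_colon A B J \<subseteq> filter_colon A' B J"
proof
  fix x assume "x \<in> filter_colon A B J"
  then obtain I where "x \<in> carrier B" "I \<in> J" "\<forall>a\<in>I. a \<odot>\<^bsub>B\<^esub> x \<in> A"
    unfolding filter_colon_def by blast
  then have "\<forall>a\<in>I. a \<odot>\<^bsub>B\<^esub> x \<in> A'" using assms by blast
  with \<open>x \<in> carrier B\<close> \<open>I \<in> J\<close> show "x \<in> filter_colon A' B J"
    unfolding filter_colon_def by blast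
qed

text \<open>Essentiality of \<open>i\<close> makes the extension \<open>j\<close> of
  \<open>\<iota>\<close> injective. Since \<open>\<iota>(M) \<subseteq> j(N)\<close>, density and
  essentiality of \<open>\<iota>\<close> pass to \<open>j\<close>.\<close>

lemma J_hull_extend:
  assumes J: "ideal_filter R J" and hull: "J_hull U R J M \<Omega> \<iota>" and bO: "baer R J \<Omega>"
    and ext: "J_extension R J M N i" and ess: "essential_extension R M N i"
  shows "\<exists>j. J_hull U R J N \<Omega> j \<and> (\<forall>x\<in>carrier M. j (i x) = \<iota> x)"
proof -
  have M: "left_module R M" and O: "left_module R \<Omega>" and io: "\<iota> \<in> left_module_hom R M \<Omega>"
    and inj: "inj_on \<iota> (carrier M)" and col: "filter_colon (\<iota> ` carrier M) \<Omega> J = carrier \<Omega>"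
    and essO: "essential_extension R M \<Omega> \<iota>" and JO: "J_injective U R J \<Omega>"
    using hull by (auto simp: J_hull_def J_extension_def)
  have N: "left_module R N" and i: "i \<in> left_module_hom R M N"
    using ext by (auto simp: J_extension_def)
  interpret N: left_module R N by fact
  interpret \<Omega>: left_module R \<Omega> by fact
  obtain j where j: "j \<in> left_module_hom R N \<Omega>" "\<And>x. x \<in> carrier M \<Longrightarrow> j (i x) = \<iota> x"
    using baer_J_extension[OF bO J ext io] by blast
  have ji: "inj_on j (carrier N)"
  proof (rule essential_hom_inj[OF ess O j(1)])
    show "x = \<zero>\<^bsub>M\<^esub>" if "x \<in> carrier M" "j (i x) = \<zero>\<^bsub>\<Omega>\<^esub>" for x
      using inj j(2) that by (simp add: left_module_hom_inj_iff[OF M O io])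
  qed
  have sub: "\<iota> ` carrier M \<subseteq> j ` carrier N"
  proof
    fix y assume "y \<in> \<iota> ` carrier M"
    then obtain x where "x \<in> carrier M" "y = j (i x)" using j(2) by auto
    then show "y \<in> j ` carrier N" using left_module_homD(1)[OF i] by blast
  qed
  have "J_extension R J N \<Omega> j"
    unfolding J_extension_def
  proof (intro conjI N O j(1) ji)
    have "filter_colon (\<iota> ` carrier M) \<Omega> J \<subseteq> filter_colon (j ` carrier N) \<Omega> J"
      by (rule filter_colon_mono[OF sub])
    then show "filter_colon (j ` carrier N) \<Omega> J = carrier \<Omega>"
      using col by (auto simp: filter_colon_def)
  qed
  moreover have "essential_extension R N \<Omega> j"
    unfolding essential_extension_def
  proof (intro conjI N O j(1) ji allI impI)
    fix B' assume B': "submodule B' R \<Omega> \<and> B' \<inter> j ` carrier N = {\<zero>\<^bsub>\<Omega>\<^esub>}"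
    have "submodule (\<iota> ` carrier M) R \<Omega>"
      by (rule left_module_hom_image_submodule[OF M O io left_module.carrier_submodule[OF M]])
    then have "B' \<inter> \<iota> ` carrier M = {\<zero>\<^bsub>\<Omega>\<^esub>}"
      using B' sub \<Omega>.submoduleD(2) by blast
    then show "B' = {\<zero>\<^bsub>\<Omega>\<^esub>}" using essO B' by (auto simp: essential_extension_def)
  qed
  ultimately show ?thesis using JO j(2) by (auto simp: J_hull_def)
qed

text \<open>\<open>\<phi>\<close> comes from \<open>J_hull_extend\<close> with
  \<open>\<Omega>\<close> as the extension of \<open>M\<close>, so it is injective and essential.
  Its left inverse \<open>\<psi>\<close> is then injective too, which makes \<open>\<phi>\<close>
  surjective.\<close>

lemma J_hull_unique:
  assumes J: "ideal_filter R J"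
    and hull: "J_hull U R J M \<Omega> \<iota>" and bO: "baer R J \<Omega>"
    and hull': "J_hull U R J M \<Omega>' \<iota>'" and bO': "baer R J \<Omega>'"
  shows "\<exists>\<phi> \<in> left_module_hom R \<Omega> \<Omega>'. bij_betw \<phi> (carrier \<Omega>) (carrier \<Omega>') \<and>
                  (\<forall>x\<in>carrier M. \<phi> (\<iota> x) = \<iota>' x)"
proof -
  have O: "left_module R \<Omega>" using bO by (simp add: baer_def)
  have "J_extension R J M \<Omega> \<iota>" "essential_extension R M \<Omega> \<iota>" using hull by (auto simp: J_hull_def)
  then obtain \<phi> where hull2: "J_hull U R J \<Omega> \<Omega>' \<phi>" and \<phi>\<iota>: "\<forall>x\<in>carrier M. \<phi> (\<iota> x) = \<iota>' x"
    using J_hull_extend[OF J hull' bO'] by blast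
  then have ext: "J_extension R J \<Omega> \<Omega>' \<phi>" and ess: "essential_extension R \<Omega> \<Omega>' \<phi>"
    by (auto simp: J_hull_def)
  then have \<phi>: "\<phi> \<in> left_module_hom R \<Omega> \<Omega>'" "inj_on \<phi> (carrier \<Omega>)"
    by (auto simp: J_extension_def)
  \<comment> \<open>Extending the identity of \<open>\<Omega>\<close> along \<open>\<phi>\<close>
    splits \<open>\<phi>\<close>.\<close>
  have "id \<in> left_module_hom R \<Omega> \<Omega>" by (simp add: left_module_hom_def)
  then obtain \<psi> where \<psi>: "\<psi> \<in> left_module_hom R \<Omega>' \<Omega>" "\<And>x. x \<in> carrier \<Omega> \<Longrightarrow> \<psi> (\<phi> x) = x"
    by (rule baer_J_extension[OF bO J ext]) auto
  have inj: "inj_on \<psi> (carrier \<Omega>')"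
  proof (rule essential_hom_inj[OF ess O \<psi>(1)])
    show "x = \<zero>\<^bsub>\<Omega>\<^esub>" if "x \<in> carrier \<Omega>" "\<psi> (\<phi> x) = \<zero>\<^bsub>\<Omega>\<^esub>" for x
      using \<psi>(2)[OF that(1)] that(2) by simp
  qed
  have "y \<in> \<phi> ` carrier \<Omega>" if y: "y \<in> carrier \<Omega>'" for y
  proof -
    have "\<psi> y \<in> carrier \<Omega>" using left_module_homD(1)[OF \<psi>(1)] y .
    \<comment> \<open>Both sides have the same image under the injective \<open>\<psi>\<close>,
      because \<open>\<psi> \<circ> \<phi>\<close> is the identity on
      \<open>\<Omega>\<close>.\<close>
    moreover from this have "\<phi> (\<psi> y) = y"
      by (intro inj_onD[OF inj] \<psi>(2) y left_module_homD(1)[OF \<phi>(1)])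
    ultimately show ?thesis by (auto simp: image_iff intro: bexI[of _ "\<psi> y"])
  qed
  then have "bij_betw \<phi> (carrier \<Omega>) (carrier \<Omega>')"
    using \<phi>(2) left_module_homD(1)[OF \<phi>(1)] by (auto simp: bij_betw_def)
  then show ?thesis using \<phi>(1) \<phi>\<iota> by blast
qed

section \<open>Divisible abelian groups and characters\<close>

text \<open>Abelian groups are viewed over \<Z> so that \<open>baer_extend\<close> applies to
  them.\<close>

definition int_module :: "('r, 'a, 'd) module_scheme \<Rightarrow> (int, 'a) module"
  where "int_module A = \<lparr>carrier = carrier A, monoid.mult = (\<lambda>x y. x),
    one = \<zero>\<^bsub>A\<^esub>, zero = \<zero>\<^bsub>A\<^esub>, add = (\<oplus>\<^bsub>A\<^esub>), smult = (\<lambda>n x. [n] \<cdot>\<^bsub>A\<^esub> x)\<rparr>"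

lemma int_module_simps [simp]:
  "carrier (int_module A) = carrier A" "\<zero>\<^bsub>int_module A\<^esub> = \<zero>\<^bsub>A\<^esub>"
  "x \<oplus>\<^bsub>int_module A\<^esub> y = x \<oplus>\<^bsub>A\<^esub> y" "n \<odot>\<^bsub>int_module A\<^esub> x = [n] \<cdot>\<^bsub>A\<^esub> x"
  by (simp_all add: int_module_def)

lemma left_module_int_module:
  assumes "abelian_group A"
  shows "left_module \<Z> (int_module A)"
proof -
  interpret A: abelian_group A by fact
  show ?thesis
  proof (rule left_moduleI)
    show "ring \<Z>" using int_is_cring by (rule cring.axioms)
    show "\<exists>y\<in>carrier (int_module A). y \<oplus>\<^bsub>int_module A\<^esub> x = \<zero>\<^bsub>int_module A\<^esub>"
      if "x \<in> carrier (int_module A)" for x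
      using that by (intro bexI[of _ "\<ominus>\<^bsub>A\<^esub> x"]) (auto simp: A.l_neg)
  qed (auto simp: A.a_ac A.add.int_pow_mult A.add.int_pow_distrib A.add.int_pow_pow mult.commute)
qed

text \<open>This group serves as injective cogenerator over \<Z>: it is divisible because complex
  roots exist, and separates elements because it has roots of unity of every order.\<close>

definition complex_units :: "(int, complex) module"
  where "complex_units = \<lparr>carrier = - {0}, monoid.mult = (*), one = 1, zero = 1, add = (*),
    smult = (\<lambda>n z. z powi n)\<rparr>"

lemma complex_units_simps [simp]:
  "carrier complex_units = - {0}" "\<zero>\<^bsub>complex_units\<^esub> = 1"
  "x \<oplus>\<^bsub>complex_units\<^esub> y = x * y" "n \<odot>\<^bsub>complex_units\<^esub> x = x powi n"
  by (simp_all add: complex_units_def)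

lemma left_module_complex_units: "left_module \<Z> complex_units"
proof (rule left_moduleI)
  show "ring \<Z>" using int_is_cring by (rule cring.axioms)
  show "\<exists>y\<in>carrier complex_units. y \<oplus>\<^bsub>complex_units\<^esub> x = \<zero>\<^bsub>complex_units\<^esub>"
    if "x \<in> carrier complex_units" for x
    using that by (intro bexI[of _ "inverse x"]) auto
  show "(a \<otimes>\<^bsub>\<Z>\<^esub> b) \<odot>\<^bsub>complex_units\<^esub> x = a \<odot>\<^bsub>complex_units\<^esub> (b \<odot>\<^bsub>complex_units\<^esub> x)" for a b x
    using power_int_mult[of x b a] by (simp add: mult.commute)
qed (auto simp: power_int_add power_int_mult_distrib)

text \<open>Division with remainder by the least positive member; \<open>d = 0\<close> stands for
  \<open>K = {0}\<close>.\<close>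

lemma int_submodule_principal:
  fixes K :: "int set"
  assumes "0 \<in> K" "\<And>m n. \<lbrakk>m \<in> K; n \<in> K\<rbrakk> \<Longrightarrow> m + n \<in> K" "\<And>m n. n \<in> K \<Longrightarrow> m * n \<in> K"
  obtains d :: nat where "K = {n. int d dvd n}"
proof (cases "K = {0}")
  case True
  then show ?thesis using that[of 0] by auto
next
  case False
  define d where "d = (LEAST d. d > 0 \<and> int d \<in> K)"
  obtain n where n: "n \<in> K" "n \<noteq> 0" using False assms(1) by blast
  then have "nat \<bar>n\<bar> > 0 \<and> int (nat \<bar>n\<bar>) \<in> K"
    using assms(3)[of n "if n < 0 then - 1 else 1"] by (auto split: if_splits)
  then have d: "d > 0" "int d \<in> K" unfolding d_def by (metis (mono_tags, lifting) LeastI)+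
  have dmin: "e = 0" if "e < d" "int e \<in> K" for e
    using not_less_Least[of e "\<lambda>d. d > 0 \<and> int d \<in> K"] that unfolding d_def by auto
  have "int d dvd n" if "n \<in> K" for n
  proof -
    have "n mod int d \<in> K"
      using assms(2)[OF that assms(3)[OF d(2), of "- (n div int d)"]]
      by (simp add: minus_div_mult_eq_mod)
    then have "int (nat (n mod int d)) \<in> K" using d(1) by simp
    moreover have "nat (n mod int d) < d" using d(1) by (simp add: nat_less_iff)
    ultimately have "nat (n mod int d) = 0" using dmin by blast
    moreover have "n mod int d \<ge> 0" using d(1) by simp
    ultimately have "n mod int d = 0" by linarith
    then show ?thesis by (rule mod_0_imp_dvd)
  qed
  moreover have "n \<in> K" if dn: "int d dvd n" for n
  proof -
    obtain k where "n = int d * k" using dn by (elim dvdE)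
    then show ?thesis using assms(3)[OF d(2), of k] by (simp add: mult.commute)
  qed
  ultimately show ?thesis using that by blast
qed

text \<open>Every ideal of \<Z> contains \<open>{0}\<close>, so this is the full Baer criterion over
  \<Z>, that is, divisibility: on the ideal generated by \<open>d\<close> the map \<open>f\<close>
  is fixed by \<open>f d\<close>, and \<open>q\<close> is a \<open>d\<close>-th root of that
  value.\<close>

lemma baer_complex_units: "baer \<Z> {{0}} complex_units"
  unfolding baer_def
proof (intro conjI allI impI left_module_complex_units; elim conjE)
  fix L f assume L: "submodule L \<Z> (regular_module \<Z>)"
    and f: "f \<in> left_module_hom \<Z> (regular_module \<Z>\<lparr>carrier := L\<rparr>) complex_units"
  interpret Z: left_module \<Z> "regular_module \<Z>"
    by (rule left_module_regular_module) (rule cring.axioms[OF int_is_cring])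
  note D = Z.submoduleD[OF L]
  obtain d :: nat where d: "L = {n. int d dvd n}"
  proof (rule int_submodule_principal[of L])
    show "0 \<in> L" "\<And>m n. \<lbrakk>m \<in> L; n \<in> L\<rbrakk> \<Longrightarrow> m + n \<in> L" "\<And>m n. n \<in> L \<Longrightarrow> m * n \<in> L"
      using D(2-4) by simp_all
  qed blast
  have dL: "int d \<in> L" by (simp add: d)
  have fd: "f (int d) \<noteq> 0" using left_module_homD(1)[OF f] dL by auto
  have "\<exists>q. q \<noteq> 0 \<and> q ^ d = f (int d)"
  proof (cases "d = 0")
    \<comment> \<open>For \<open>d = 0\<close> the ideal is zero and \<open>q = 1\<close> will
      do.\<close>
    case True
    have "f 0 = 1"
      using left_module_hom_zero[OF Z.submodule_left_module[OF L] left_module_complex_units f]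
      by simp
    then show ?thesis using True by (intro exI[of _ 1]) simp
  next
    case False
    \<comment> \<open>A nonzero complex number has exactly \<open>d\<close> distinct
      \<open>d\<close>-th roots, in particular at least one.\<close>
    then have "card {z. z ^ d = f (int d)} = d" using fd by (simp add: card_nth_roots)
    then have "{z. z ^ d = f (int d)} \<noteq> {}" using False by (intro notI) simp
    then obtain q where q: "q ^ d = f (int d)" by blast
    have "q \<noteq> 0" using q fd False by (intro notI) (simp add: power_0_left)
    then show ?thesis using q by blast
  qed
  then obtain q where q: "q \<noteq> 0" "q ^ d = f (int d)" by blast
  show "\<exists>q\<in>carrier complex_units. \<forall>r\<in>L. f r = r \<odot>\<^bsub>complex_units\<^esub> q"
  proof (intro bexI ballI)
    fix r assume "r \<in> L"
    then have "int d dvd r" using d by simp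
    then obtain k where "r = int d * k" by (elim dvdE)
    then have k: "r = k * int d" by simp
    have "f r = f (int d) powi k"
      using left_module_homD(3)[OF f, of k "int d"] dL by (simp add: k)
    also have "\<dots> = r \<odot>\<^bsub>complex_units\<^esub> q"
      unfolding k q(2)[symmetric] complex_units_simps mult.commute[of k]
      by (simp add: power_int_mult)
    finally show "f r = r \<odot>\<^bsub>complex_units\<^esub> q" .
  qed (use q in simp)
qed

text \<open>Membership of \<open>{0}\<close> in the family of ideals makes the density condition of the Baer
  criterion void over \<open>\<Z>\<close>.\<close>

lemma complex_units_extend:
  assumes B: "left_module \<Z> B" and G0: "submodule G\<^sub>0 \<Z> (prod_module B complex_units)"
    and single: "\<And>y. (\<zero>\<^bsub>B\<^esub>, y) \<in> G\<^sub>0 \<Longrightarrow> y = 1"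
  obtains g where "g \<in> left_module_hom \<Z> B complex_units" "\<And>x y. (x, y) \<in> G\<^sub>0 \<Longrightarrow> g x = y"
proof -
  interpret B: left_module \<Z> B by fact
  interpret P: left_module \<Z> "prod_module B complex_units"
    by (rule left_module_prod_module[OF B left_module_complex_units])
  have "\<zero>\<^bsub>B\<^esub> \<in> fst ` G\<^sub>0" using imageI[OF P.submoduleD(2)[OF G0], of fst] by simp
  moreover have "0 \<odot>\<^bsub>B\<^esub> x = \<zero>\<^bsub>B\<^esub>" if "x \<in> carrier B" for x using B.smult_l_null that by simp
  ultimately show ?thesis
    using single by (intro baer_extend[OF baer_complex_units B G0 _ _ that]) auto
qed

text \<open>On the cyclic group generated by \<open>x\<close>, send \<open>x\<close> to some
  \<open>z \<noteq> 1\<close> that obeys the relations of \<open>x\<close>; then extend to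
  \<open>A\<close> by injectivity of \<open>complex_units\<close>.\<close>

lemma separating_character:
  assumes A: "abelian_group A" and x: "x \<in> carrier A" "x \<noteq> \<zero>\<^bsub>A\<^esub>"
  obtains \<chi> where "\<chi> \<in> left_module_hom \<Z> (int_module A) complex_units" "\<chi> x \<noteq> 1"
proof -
  interpret A: abelian_group A by fact
  interpret ZA: left_module \<Z> "int_module A" by (rule left_module_int_module[OF A])
  interpret P: left_module \<Z> "prod_module (int_module A) complex_units"
    by (rule left_module_prod_module[OF ZA.left_module_axioms left_module_complex_units])
  \<comment> \<open>\<open>K\<close> is the annihilator of \<open>x\<close>; its generator
    \<open>d\<close> is the order of \<open>x\<close>, with \<open>d = 0\<close> for infinite
    order.\<close>
  define K where "K = {n::int. [n] \<cdot>\<^bsub>A\<^esub> x = \<zero>\<^bsub>A\<^esub>}"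
  obtain d :: nat where d: "K = {n. int d dvd n}"
  proof (rule int_submodule_principal[of K])
    show "0 \<in> K" using ZA.smult_l_null[of x] x by (simp add: K_def)
    show "m + n \<in> K" if "m \<in> K" "n \<in> K" for m n
      using ZA.smult_l_distr[of m n x] x that by (simp add: K_def)
    show "m * n \<in> K" if "n \<in> K" for m n
      using ZA.smult_assoc1[of m n x] ZA.smult_r_null[of m] x that by (simp add: K_def)
  qed blast
  have d1: "d \<noteq> 1"
  proof
    assume "d = 1"
    then have "1 \<in> K" using d by simp
    then show False using x by (simp add: K_def)
  qed
  have "\<exists>z::complex. z \<noteq> 0 \<and> z \<noteq> 1 \<and> z ^ d = 1"
  proof (cases "d = 0")
    case True
    \<comment> \<open>Infinite order imposes no relation, so any \<open>z\<close> other than 0 and 1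
      is allowed.\<close>
    then show ?thesis by (intro exI[of _ 2]) simp
  next
    case False
    then have c: "card {z::complex. z ^ d = 1} = d" by (intro card_roots_unity_eq) simp
    \<comment> \<open>There are \<open>d\<close> roots of unity of this kind and
      \<open>d \<noteq> 1\<close>, so one of them differs from 1.\<close>
    have "{z::complex. z ^ d = 1} \<noteq> {1}" using c d1 by (intro notI) simp
    moreover have "1 \<in> {z::complex. z ^ d = 1}" by simp
    ultimately obtain z :: complex where "z ^ d = 1" "z \<noteq> 1" by blast
    moreover from this have "z \<noteq> 0" using False by (intro notI) (simp add: power_0_left)
    ultimately show ?thesis by blast
  qed
  then obtain z :: complex where z: "z \<noteq> 0" "z \<noteq> 1" "z ^ d = 1" by blast
  \<comment> \<open>Hence sending \<open>n x\<close> to \<open>z powi n\<close> is well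
    defined.\<close>
  have zK: "z powi n = 1" if "[n] \<cdot>\<^bsub>A\<^esub> x = \<zero>\<^bsub>A\<^esub>" for n :: int
  proof -
    have "int d dvd n" using that d by (auto simp: K_def)
    then obtain k where "n = int d * k" by (elim dvdE)
    then show ?thesis using z(3) by (simp add: power_int_mult)
  qed
  let ?G = "range (\<lambda>n::int. ([n] \<cdot>\<^bsub>A\<^esub> x, z powi n))"
  have GI: "([n] \<cdot>\<^bsub>A\<^esub> x, z powi n) \<in> ?G" for n :: int by blast
  have "submodule ?G \<Z> (prod_module (int_module A) complex_units)"
  proof (rule P.submoduleI)
    show "\<zero>\<^bsub>prod_module (int_module A) complex_units\<^esub> \<in> ?G"
      using GI[of 0] ZA.smult_l_null[of x] x by simp
    show "p \<oplus>\<^bsub>prod_module (int_module A) complex_units\<^esub> p' \<in> ?G" if pG: "p \<in> ?G" "p' \<in> ?G" for p p'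
    proof -
      obtain m n :: int where "p = ([m] \<cdot>\<^bsub>A\<^esub> x, z powi m)" "p' = ([n] \<cdot>\<^bsub>A\<^esub> x, z powi n)"
        using pG by blast
      then show ?thesis using GI[of "m + n"] x z by (simp add: A.add.int_pow_mult power_int_add)
    qed
    show "a \<odot>\<^bsub>prod_module (int_module A) complex_units\<^esub> p \<in> ?G" if pG: "p \<in> ?G" for a p
    proof -
      obtain n :: int where "p = ([n] \<cdot>\<^bsub>A\<^esub> x, z powi n)" using pG by blast
      then show ?thesis using GI[of "n * a"] x
        by (simp add: A.add.int_pow_pow flip: power_int_mult)
    qed
  qed (use x z in auto)
  then obtain \<chi> where \<chi>: "\<chi> \<in> left_module_hom \<Z> (int_module A) complex_units"
    "\<And>a b. (a, b) \<in> ?G \<Longrightarrow> \<chi> a = b"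
    by (rule complex_units_extend[OF ZA.left_module_axioms]) (use zK in auto)
  have "\<chi> x = z" using \<chi>(2)[OF GI[of 1]] x by simp
  then show ?thesis using that \<chi>(1) z(2) by blast
qed

section \<open>Extending characters from subgroups\<close>

text \<open>Scalars reduce to iterated addition; a negative \<open>n\<close> acts on
  \<open>x\<close> as \<open>- n\<close> acts on the inverse of \<open>x\<close>.\<close>

lemma int_submoduleI:
  assumes A: "left_module \<Z> A" and S: "S \<subseteq> carrier A" "\<zero>\<^bsub>A\<^esub> \<in> S"
    and add: "\<And>x y. \<lbrakk>x \<in> S; y \<in> S\<rbrakk> \<Longrightarrow> x \<oplus>\<^bsub>A\<^esub> y \<in> S"
    and neg: "\<And>x. x \<in> S \<Longrightarrow> \<ominus>\<^bsub>A\<^esub> x \<in> S"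
  shows "submodule S \<Z> A"
proof -
  interpret A: left_module \<Z> A by fact
  have nat: "int n \<odot>\<^bsub>A\<^esub> x \<in> S" if x: "x \<in> S" for n x
  proof (induction n)
    case 0
    show ?case using A.smult_l_null[of x] x S by auto
  next
    case (Suc n)
    have "int (Suc n) \<odot>\<^bsub>A\<^esub> x = x \<oplus>\<^bsub>A\<^esub> int n \<odot>\<^bsub>A\<^esub> x"
      using A.smult_l_distr[of 1 "int n" x] A.smult_one[of x] x S by auto
    then show ?case using add[OF x Suc.IH] by (simp only:)
  qed
  have "n \<odot>\<^bsub>A\<^esub> x \<in> S" if x: "x \<in> S" for n x
  proof (cases "n \<ge> 0")
    case True
    then show ?thesis using nat[OF x, of "nat n"] by simp
  next
    case False
    have xc: "x \<in> carrier A" using x S by blast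
    have "\<ominus>\<^bsub>A\<^esub> x = (- 1) \<odot>\<^bsub>A\<^esub> x"
      using A.M.minus_equality[of "(- 1) \<odot>\<^bsub>A\<^esub> x" x] A.smult_l_distr[of "- 1" 1 x]
        A.smult_one[OF xc] A.smult_l_null[OF xc] xc by simp
    then have "int (nat (- n)) \<odot>\<^bsub>A\<^esub> (\<ominus>\<^bsub>A\<^esub> x) = n \<odot>\<^bsub>A\<^esub> x"
      using A.smult_assoc1[of "- n" "- 1" x] xc False by simp
    then show ?thesis using nat[OF neg[OF x], of "nat (- n)"] by (simp only:)
  qed
  then show ?thesis using S add by (intro A.submoduleI) auto
qed

text \<open>The graph of \<open>c\<close> over the subgroup \<open>L\<close> is a submodule over
  \<Z>, and injectivity of \<open>complex_units\<close> extends it.\<close>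

lemma additive_extend:
  assumes A: "abelian_group A" and L: "L \<subseteq> carrier A" "\<zero>\<^bsub>A\<^esub> \<in> L"
      "\<And>x y. \<lbrakk>x \<in> L; y \<in> L\<rbrakk> \<Longrightarrow> x \<oplus>\<^bsub>A\<^esub> y \<in> L" "\<And>x. x \<in> L \<Longrightarrow> \<ominus>\<^bsub>A\<^esub> x \<in> L"
    and c: "\<And>x. x \<in> L \<Longrightarrow> c x \<noteq> 0"
    and cadd: "\<And>x y. \<lbrakk>x \<in> L; y \<in> L\<rbrakk> \<Longrightarrow> c (x \<oplus>\<^bsub>A\<^esub> y) = c x * c y"
  obtains g where "g \<in> left_module_hom \<Z> (int_module A) complex_units" "\<And>x. x \<in> L \<Longrightarrow> g x = c x"
proof -
  interpret A: abelian_group A by fact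
  let ?P = "prod_module (int_module A) complex_units"
  have P: "left_module \<Z> ?P"
    by (rule left_module_prod_module[OF left_module_int_module[OF A] left_module_complex_units])
  interpret P: left_module \<Z> ?P by fact
  have c0: "c \<zero>\<^bsub>A\<^esub> = 1" using cadd[OF L(2) L(2)] c[OF L(2)] by simp
  let ?G = "(\<lambda>x. (x, c x)) ` L"
  have "submodule ?G \<Z> ?P"
  proof (rule int_submoduleI[OF P])
    show "?G \<subseteq> carrier ?P" using L(1) c by auto
    show "\<zero>\<^bsub>?P\<^esub> \<in> ?G" using L(2) c0 by (simp add: image_iff)
    show "p \<oplus>\<^bsub>?P\<^esub> p' \<in> ?G" if "p \<in> ?G" "p' \<in> ?G" for p p'
      using that L(3) cadd by (auto simp: image_iff)
    show "\<ominus>\<^bsub>?P\<^esub> p \<in> ?G" if p: "p \<in> ?G" for p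
    proof -
      obtain x where x: "x \<in> L" "p = (x, c x)" using p by blast
      have "c (\<ominus>\<^bsub>A\<^esub> x) * c x = 1" using cadd[OF L(4)[OF x(1)] x(1)] x L(1) c0
        by (simp add: A.l_neg subset_eq)
      then have "\<ominus>\<^bsub>?P\<^esub> p = (\<ominus>\<^bsub>A\<^esub> x, c (\<ominus>\<^bsub>A\<^esub> x))"
        using x L(1) c[OF x(1)] c[OF L(4)[OF x(1)]]
        by (intro P.M.minus_equality) (auto simp: A.l_neg)
      then show ?thesis using L(4)[OF x(1)] by (simp add: image_iff)
    qed
  qed
  then obtain g where "g \<in> left_module_hom \<Z> (int_module A) complex_units"
      "\<And>x y. (x, y) \<in> ?G \<Longrightarrow> g x = y"
    by (rule complex_units_extend[OF left_module_int_module[OF A]]) (auto simp: c0)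
  then show ?thesis using that by blast
qed

section \<open>An embedding into an injective module\<close>

text \<open>The product over all \<open>k\<close> of the groups of homomorphisms from
  \<open>R\<close> to \<open>complex_units\<close>, with action \<open>(s F)(r) = F(r s)\<close>.
  The value 1 outside \<open>carrier R\<close> makes elements that agree on \<open>R\<close> equal
  as functions.\<close>

definition coinduced_module :: "('r, 'c) ring_scheme \<Rightarrow> ('r, 'k \<Rightarrow> 'r \<Rightarrow> complex) module"
  where "coinduced_module R = \<lparr>
    carrier = {F. \<forall>k. (\<forall>r\<in>carrier R. F k r \<noteq> 0) \<and> (\<forall>r. r \<notin> carrier R \<longrightarrow> F k r = 1) \<and>
      (\<forall>r\<in>carrier R. \<forall>s\<in>carrier R. F k (r \<oplus>\<^bsub>R\<^esub> s) = F k r * F k s)},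
    monoid.mult = (\<lambda>F G. F), one = (\<lambda>k r. 1), zero = (\<lambda>k r. 1),
    add = (\<lambda>F G k r. F k r * G k r),
    smult = (\<lambda>s F k r. if r \<in> carrier R then F k (r \<otimes>\<^bsub>R\<^esub> s) else 1)\<rparr>"

lemma coinduced_module_simps [simp]:
  "\<zero>\<^bsub>coinduced_module R\<^esub> = (\<lambda>k r. 1)"
  "F \<oplus>\<^bsub>coinduced_module R\<^esub> G = (\<lambda>k r. F k r * G k r)"
  "s \<odot>\<^bsub>coinduced_module R\<^esub> F = (\<lambda>k r. if r \<in> carrier R then F k (r \<otimes>\<^bsub>R\<^esub> s) else 1)"
  by (simp_all add: coinduced_module_def)

lemma coinduced_carrier_iff:
  "F \<in> carrier (coinduced_module R) \<longleftrightarrow>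
    (\<forall>k. (\<forall>r\<in>carrier R. F k r \<noteq> 0) \<and> (\<forall>r. r \<notin> carrier R \<longrightarrow> F k r = 1) \<and>
      (\<forall>r\<in>carrier R. \<forall>s\<in>carrier R. F k (r \<oplus>\<^bsub>R\<^esub> s) = F k r * F k s))"
  by (simp add: coinduced_module_def)

lemma left_module_coinduced_module:
  assumes "ring R"
  shows "left_module R (coinduced_module R)"
proof -
  interpret ring R by fact
  show ?thesis
  proof (rule left_moduleI[OF assms])
    show "\<exists>G\<in>carrier (coinduced_module R). G \<oplus>\<^bsub>coinduced_module R\<^esub> F = \<zero>\<^bsub>coinduced_module R\<^esub>"
      if "F \<in> carrier (coinduced_module R)" for F
    proof
      have "F k r \<noteq> 0" for k r using that unfolding coinduced_carrier_iff by (metis zero_neq_one)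
      then show "(\<lambda>k r. inverse (F k r)) \<oplus>\<^bsub>coinduced_module R\<^esub> F = \<zero>\<^bsub>coinduced_module R\<^esub>"
        by simp
      show "(\<lambda>k r. inverse (F k r)) \<in> carrier (coinduced_module R)"
        using that by (simp add: coinduced_carrier_iff)
    qed
  qed (auto simp: coinduced_carrier_iff fun_eq_iff l_distr r_distr m_assoc)
qed

text \<open>Adjunction: \<open>f\<close> is determined in each coordinate \<open>k\<close> by the
  character of \<open>L\<close> sending \<open>x\<close> to \<open>f x k \<one>\<close>. Extensions
  of these characters to \<open>R\<close> are the coordinates of \<open>q\<close>.\<close>

lemma baer_coinduced_module:
  assumes R: "ring R"
  shows "baer R J (coinduced_module R)"
  unfolding baer_def
proof (intro conjI allI impI left_module_coinduced_module[OF R]; elim conjE)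
  interpret RR: left_module R "regular_module R" by (rule left_module_regular_module[OF R])
  fix L f assume L: "submodule L R (regular_module R)"
    and f: "f \<in> left_module_hom R (regular_module R\<lparr>carrier := L\<rparr>) (coinduced_module R)"
  note D = RR.submoduleD[OF L]
  note F = left_module_homD[OF f, simplified]
  have F1: "f x \<in> carrier (coinduced_module R)" if "x \<in> L" for x using F(1) that .
  have "\<exists>g. g \<in> left_module_hom \<Z> (int_module (regular_module R)) complex_units \<and>
      (\<forall>x\<in>L. g x = f x k \<one>\<^bsub>R\<^esub>)" for k
  proof -
    obtain g where "g \<in> left_module_hom \<Z> (int_module (regular_module R)) complex_units"
        "\<And>x. x \<in> L \<Longrightarrow> g x = f x k \<one>\<^bsub>R\<^esub>"
    proof (rule additive_extend[OF RR.M.abelian_group_axioms D(1,2,3,5)])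
      show "f x k \<one>\<^bsub>R\<^esub> \<noteq> 0" if "x \<in> L" for x
        using F1[OF that] unfolding coinduced_carrier_iff by simp
      show "f (x \<oplus>\<^bsub>regular_module R\<^esub> y) k \<one>\<^bsub>R\<^esub> = f x k \<one>\<^bsub>R\<^esub> * f y k \<one>\<^bsub>R\<^esub>"
        if "x \<in> L" "y \<in> L" for x y using F(2)[OF that] by simp
    qed (assumption | rule that | blast)+
    then show ?thesis by blast
  qed
  then obtain g where g: "\<And>k. g k \<in> left_module_hom \<Z> (int_module (regular_module R)) complex_units"
    "\<And>k x. x \<in> L \<Longrightarrow> g k x = f x k \<one>\<^bsub>R\<^esub>" by metis
  show "\<exists>q\<in>carrier (coinduced_module R). \<forall>r\<in>L. f r = r \<odot>\<^bsub>coinduced_module R\<^esub> q"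
  proof (intro bexI ballI)
    let ?q = "\<lambda>k r. if r \<in> carrier R then g k r else 1"
    show "?q \<in> carrier (coinduced_module R)"
      using left_module_homD(1,2)[OF g(1)] by (simp add: coinduced_carrier_iff)
    fix x assume x: "x \<in> L"
    have xc: "x \<in> carrier R" using x D(1) by auto
    have "f x k r = (x \<odot>\<^bsub>coinduced_module R\<^esub> ?q) k r" for k r
    proof (cases "r \<in> carrier R")
      case True
      \<comment> \<open>The coordinate of \<open>x q\<close> at \<open>r\<close> is
        \<open>g k (r x)\<close>, and \<open>f (r x)\<close> at \<open>\<one>\<close> equals
        \<open>f x\<close> at \<open>r\<close> by linearity of \<open>f\<close>.\<close>
      have "g k (r \<otimes>\<^bsub>R\<^esub> x) = f (r \<otimes>\<^bsub>R\<^esub> x) k \<one>\<^bsub>R\<^esub>"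
        using g(2) D(4)[OF True x] by simp
      also have "\<dots> = f x k r" using F(3)[OF True x] True by simp
      finally show ?thesis using True xc by simp
    next
      case False
      then show ?thesis using F1[OF x] by (simp add: coinduced_carrier_iff)
    qed
    then show "f x = x \<odot>\<^bsub>coinduced_module R\<^esub> ?q" by blast
  qed
qed

section \<open>Embedding a module by its characters\<close>

text \<open>Coordinates are indexed by all functions from \<open>'m\<close> to
  \<open>complex\<close>; those that are not characters receive the neutral value 1.\<close>

definition character_embedding ::
    "('r, 'c) ring_scheme \<Rightarrow> ('r, 'm, 'd) module_scheme \<Rightarrow> 'm \<Rightarrow> ('m \<Rightarrow> complex) \<Rightarrow> 'r \<Rightarrow> complex"
  where "character_embedding R M x \<chi> r =
    (if r \<in> carrier R \<and> \<chi> \<in> left_module_hom \<Z> (int_module M) complex_units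
     then \<chi> (r \<odot>\<^bsub>M\<^esub> x) else 1)"

text \<open>Every character is 1 at an element of the kernel, as the coordinates at
  \<open>r = \<one>\<close> show; \<open>separating_character\<close> then makes the element
  zero.\<close>

lemma character_embedding:
  assumes M: "left_module R M"
  shows "character_embedding R M \<in> left_module_hom R M (coinduced_module R)"
    "inj_on (character_embedding R M) (carrier M)"
proof -
  interpret M: left_module R M by fact
  have hom: "\<chi> x \<noteq> 0" "\<chi> (x \<oplus>\<^bsub>M\<^esub> y) = \<chi> x * \<chi> y"
    if "\<chi> \<in> left_module_hom \<Z> (int_module M) complex_units" "x \<in> carrier M" "y \<in> carrier M" for \<chi> x y
    using left_module_homD(1,2)[OF that(1)] that(2,3) by auto
  let ?e = "character_embedding R M" and ?E = "coinduced_module R"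
  have "?e x \<in> carrier ?E" if "x \<in> carrier M" for x
    using that by (simp add: coinduced_carrier_iff character_embedding_def hom M.smult_l_distr)
  moreover have "?e (x \<oplus>\<^bsub>M\<^esub> y) = ?e x \<oplus>\<^bsub>?E\<^esub> ?e y" if "x \<in> carrier M" "y \<in> carrier M" for x y
    using that by (simp add: fun_eq_iff character_embedding_def hom M.smult_r_distr)
  moreover have "?e (r \<odot>\<^bsub>M\<^esub> x) = r \<odot>\<^bsub>?E\<^esub> ?e x" if "r \<in> carrier R" "x \<in> carrier M" for r x
    using that by (simp add: fun_eq_iff character_embedding_def M.smult_assoc1)
  ultimately show e: "?e \<in> left_module_hom R M ?E"
    unfolding left_module_hom_def by blast
  show "inj_on (character_embedding R M) (carrier M)"
    unfolding left_module_hom_inj_iff[OF M left_module_coinduced_module[OF M.R.ring_axioms] e]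
  proof (intro ballI impI)
    fix x assume x: "x \<in> carrier M" "character_embedding R M x = \<zero>\<^bsub>coinduced_module R\<^esub>"
    have "\<chi> x = 1" if "\<chi> \<in> left_module_hom \<Z> (int_module M) complex_units" for \<chi>
      using fun_cong[OF fun_cong[OF x(2), of \<chi>], of "\<one>\<^bsub>R\<^esub>"] that x(1)
      by (simp add: character_embedding_def)
    then show "x = \<zero>\<^bsub>M\<^esub>"
      using separating_character[OF M.M.abelian_group_axioms x(1)] by blast
  qed
qed

section \<open>Existence of hulls\<close>

text \<open>Sums use closure of \<open>J\<close> under intersection; scalar multiples use that its
  members are right ideals.\<close>

lemma filter_colon_submodule:
  assumes B: "left_module R B" and J: "ideal_filter R J" and A: "submodule A R B"
  shows "submodule (filter_colon A B J) R B" "A \<subseteq> filter_colon A B J"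
proof -
  interpret B: left_module R B by fact
  note D = B.submoduleD[OF A] and JD = ideal_filterD[OF J]
  have mem: "x \<in> filter_colon A B J \<longleftrightarrow> x \<in> carrier B \<and> (\<exists>I\<in>J. \<forall>a\<in>I. a \<odot>\<^bsub>B\<^esub> x \<in> A)" for x
    by (simp add: filter_colon_def)
  obtain I\<^sub>0 where I0: "I\<^sub>0 \<in> J" using JD(4) by blast
  show sub: "A \<subseteq> filter_colon A B J"
  proof
    fix x assume x: "x \<in> A"
    then have "\<forall>a\<in>I\<^sub>0. a \<odot>\<^bsub>B\<^esub> x \<in> A" using D(4) JD(1)[OF I0] by blast
    then show "x \<in> filter_colon A B J" unfolding mem using I0 x D(1) by blast
  qed
  show "submodule (filter_colon A B J) R B"
  proof (rule B.submoduleI)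
    show "filter_colon A B J \<subseteq> carrier B" using mem by blast
    show "\<zero>\<^bsub>B\<^esub> \<in> filter_colon A B J" using sub D(2) by blast
  next
    fix x y assume "x \<in> filter_colon A B J" "y \<in> filter_colon A B J"
    then obtain I I' where I: "x \<in> carrier B" "I \<in> J" "\<forall>a\<in>I. a \<odot>\<^bsub>B\<^esub> x \<in> A"
      and I': "y \<in> carrier B" "I' \<in> J" "\<forall>a\<in>I'. a \<odot>\<^bsub>B\<^esub> y \<in> A" unfolding mem by blast
    have "a \<odot>\<^bsub>B\<^esub> (x \<oplus>\<^bsub>B\<^esub> y) \<in> A" if a: "a \<in> I \<inter> I'" for a
    proof -
      have "a \<in> carrier R" using JD(1)[OF I(2)] a by blast
      then show ?thesis using D(3) I I' a by (simp add: B.smult_r_distr)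
    qed
    then show "x \<oplus>\<^bsub>B\<^esub> y \<in> filter_colon A B J"
      unfolding mem using JD(3)[OF I(2) I'(2)] I(1) I'(1) by blast
  next
    fix r x assume r: "r \<in> carrier R" and "x \<in> filter_colon A B J"
    then obtain I where I: "x \<in> carrier B" "I \<in> J" "\<forall>a\<in>I. a \<odot>\<^bsub>B\<^esub> x \<in> A" unfolding mem by blast
    have "a \<odot>\<^bsub>B\<^esub> (r \<odot>\<^bsub>B\<^esub> x) \<in> A" if a: "a \<in> I" for a
    proof -
      have ac: "a \<in> carrier R" using JD(1)[OF I(2)] a by blast
      \<comment> \<open>The same \<open>I\<close> works for \<open>r x\<close>, since
        \<open>a r \<in> I\<close>.\<close>
      have "(a \<otimes>\<^bsub>R\<^esub> r) \<odot>\<^bsub>B\<^esub> x \<in> A" using I(3) JD(2)[OF I(2) a r] by blast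
      then show ?thesis by (simp only: B.smult_assoc1[OF ac r I(1)])
    qed
    then show "r \<odot>\<^bsub>B\<^esub> x \<in> filter_colon A B J"
      unfolding mem using I(1,2) r B.smult_closed by blast
  qed
qed

text \<open>\<open>E\<close> supplies a multiplier \<open>q\<close>, and \<open>f(I) = I q\<close>
  lies in \<open>(N : J)\<close>. Completeness, applied to the left ideal of all \<open>r\<close>
  with \<open>r q \<in> N\<close>, yields one \<open>K \<in> J\<close> with
  \<open>K q \<subseteq> N\<close>, hence \<open>q \<in> (N : J)\<close>.\<close>

lemma baer_filter_colon:
  fixes R :: "('r, 'c) ring_scheme"
  assumes J: "ideal_filter R J" and comp: "complete_filter TYPE('r + 'u) R J"
    and E: "baer R J E" and N: "submodule N R E"
  shows "baer R J (E\<lparr>carrier := filter_colon N E J\<rparr>)"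
proof -
  have Em: "left_module R E" using E by (simp add: baer_def)
  interpret E: left_module R E by fact
  let ?C = "filter_colon N E J"
  have C: "submodule ?C R E" by (rule filter_colon_submodule[OF Em J N])
  have Cc: "?C \<subseteq> carrier E" by (rule E.submoduleD(1)[OF C])
  have reg: "left_module R (regular_module R)" by (rule left_module_regular_module[OF E.R.ring_axioms])
  show ?thesis
    unfolding baer_def
  proof (intro conjI allI impI E.submodule_left_module[OF C]; elim conjE bexE)
    fix L f I assume L: "submodule L R (regular_module R)" and I: "I \<in> J" "I \<subseteq> L"
      and f: "f \<in> left_module_hom R (regular_module R\<lparr>carrier := L\<rparr>) (E\<lparr>carrier := ?C\<rparr>)"
    have "f \<in> left_module_hom R (regular_module R\<lparr>carrier := L\<rparr>) E"
      using f Cc by (auto simp: left_module_hom_def)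
    then obtain q where q: "q \<in> carrier E" "\<And>r. r \<in> L \<Longrightarrow> f r = r \<odot>\<^bsub>E\<^esub> q"
      using E L I unfolding baer_def by blast
    have "(\<lambda>r. r \<odot>\<^bsub>E\<^esub> q) \<in> left_module_hom R (regular_module R) E"
      using q(1) by (simp add: left_module_hom_def E.smult_l_distr E.smult_assoc1)
    from left_module_hom_vimage_submodule[OF reg Em this N]
    have L': "submodule {r \<in> carrier R. r \<odot>\<^bsub>E\<^esub> q \<in> N} R (regular_module R)" by simp
    obtain K where K: "K \<in> J" "K \<subseteq> {r \<in> carrier R. r \<odot>\<^bsub>E\<^esub> q \<in> N}"
    proof (rule complete_filter_left_ideal[OF E.R.ring_axioms J comp L' I(1)])
      fix a assume a: "a \<in> I"
      then have ac: "a \<in> carrier R" using ideal_filterD(1)[OF J I(1)] by blast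
      have "f a \<in> ?C" using left_module_homD(1)[OF f, of a] a I(2) by auto
      then have "a \<odot>\<^bsub>E\<^esub> q \<in> ?C" using q(2) a I(2) by auto
      then obtain K where K: "K \<in> J" "\<forall>b\<in>K. b \<odot>\<^bsub>E\<^esub> (a \<odot>\<^bsub>E\<^esub> q) \<in> N"
        unfolding filter_colon_def by blast
      have "b \<otimes>\<^bsub>R\<^esub> a \<in> {r \<in> carrier R. r \<odot>\<^bsub>E\<^esub> q \<in> N}" if b: "b \<in> K" for b
      proof -
        have "b \<in> carrier R" using ideal_filterD(1)[OF J K(1)] b by blast
        then show ?thesis using K(2) b ac q(1) by (simp add: E.smult_assoc1)
      qed
      then show "\<exists>K\<in>J. \<forall>b\<in>K. b \<otimes>\<^bsub>R\<^esub> a \<in> {r \<in> carrier R. r \<odot>\<^bsub>E\<^esub> q \<in> N}" using K(1) by blast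
    qed (rule that)
    then have "\<forall>a\<in>K. a \<odot>\<^bsub>E\<^esub> q \<in> N" by blast
    then have "q \<in> ?C" using K(1) q(1) unfolding filter_colon_def by blast
    then show "\<exists>q\<in>carrier (E\<lparr>carrier := ?C\<rparr>). \<forall>r\<in>L. f r = r \<odot>\<^bsub>E\<lparr>carrier := ?C\<rparr>\<^esub> q"
      using q(2) by auto
  qed
qed

text \<open>The multiplier \<open>q\<close> found in \<open>C\<close> is replaced by
  \<open>g q\<close>; this keeps the products, because the values of \<open>f\<close> lie in
  \<open>S\<close> and are fixed by \<open>g\<close>.\<close>

lemma baer_retract:
  assumes C: "baer R J C" and S: "submodule S R C"
    and g: "g \<in> left_module_hom R C C" "g ` carrier C \<subseteq> S" "\<And>x. x \<in> S \<Longrightarrow> g x = x"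
  shows "baer R J (C\<lparr>carrier := S\<rparr>)"
proof -
  have Cm: "left_module R C" using C by (simp add: baer_def)
  interpret C: left_module R C by fact
  interpret RR: left_module R "regular_module R"
    by (rule left_module_regular_module[OF C.R.ring_axioms])
  note D = C.submoduleD[OF S]
  show ?thesis
    unfolding baer_def
  proof (intro conjI allI impI C.submodule_left_module[OF S]; elim conjE)
    fix L f assume L: "submodule L R (regular_module R)" "\<exists>I\<in>J. I \<subseteq> L"
      and f: "f \<in> left_module_hom R (regular_module R\<lparr>carrier := L\<rparr>) (C\<lparr>carrier := S\<rparr>)"
    have "f \<in> left_module_hom R (regular_module R\<lparr>carrier := L\<rparr>) C"
      using f D(1) by (auto simp: left_module_hom_def)
    then obtain q where q: "q \<in> carrier C" "\<And>r. r \<in> L \<Longrightarrow> f r = r \<odot>\<^bsub>C\<^esub> q"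
      using C L unfolding baer_def by blast
    have "f r = r \<odot>\<^bsub>C\<^esub> g q" if r: "r \<in> L" for r
    proof -
      have "r \<in> carrier R" using RR.submoduleD(1)[OF L(1)] r by auto
      then have "g (f r) = r \<odot>\<^bsub>C\<^esub> g q" using left_module_homD(3)[OF g(1)] q r by simp
      moreover have "f r \<in> S" using left_module_homD(1)[OF f, of r] r by simp
      ultimately show ?thesis using g(3) by simp
    qed
    moreover have "g q \<in> S" using g(2) q(1) by blast
    ultimately show "\<exists>q\<in>carrier (C\<lparr>carrier := S\<rparr>). \<forall>r\<in>L. f r = r \<odot>\<^bsub>C\<lparr>carrier := S\<rparr>\<^esub> q"
      by auto
  qed
qed

text \<open>\<open>S\<close> is a maximal essential extension of \<open>N\<close> inside \<open>C\<close>.  With \<open>K\<close> maximal among the submodules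
  meeting \<open>S\<close> trivially, an endomorphism \<open>g\<close> of \<open>C\<close> that is the identity on \<open>S\<close> and vanishes on \<open>K\<close>
  has kernel \<open>K\<close> and an image essential over \<open>S\<close>, so \<open>g\<close> is a retraction onto \<open>S\<close>.\<close>

lemma baer_maximal_essential:
  assumes C: "baer R J C" and J: "ideal_filter R J" and N: "submodule N R C"
    and dense: "filter_colon N C J = carrier C"
  obtains S where "submodule S R C" "N \<subseteq> S" "baer R J (C\<lparr>carrier := S\<rparr>)"
    "\<And>x. \<lbrakk>x \<in> S; x \<noteq> \<zero>\<^bsub>C\<^esub>\<rbrakk> \<Longrightarrow> \<exists>r\<in>carrier R. r \<odot>\<^bsub>C\<^esub> x \<in> N \<and> r \<odot>\<^bsub>C\<^esub> x \<noteq> \<zero>\<^bsub>C\<^esub>"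
proof -
  have Cm: "left_module R C" using C by (simp add: baer_def)
  interpret C: left_module R C by fact
  interpret P: left_module R "prod_module C C" by (rule left_module_prod_module[OF Cm Cm])
  \<comment> \<open>Essentiality over \<open>N\<close>, stated elementwise: a nonzero
    \<open>x\<close> has a nonzero multiple in \<open>N\<close>. The premise lets the zero element
    satisfy \<open>Q\<close>, as \<open>submodule_Zorn\<close> requires.\<close>
  define Q where "Q x \<longleftrightarrow> (x \<noteq> \<zero>\<^bsub>C\<^esub> \<longrightarrow> (\<exists>r\<in>carrier R. r \<odot>\<^bsub>C\<^esub> x \<in> N \<and> r \<odot>\<^bsub>C\<^esub> x \<noteq> \<zero>\<^bsub>C\<^esub>))" for x
  have Q0: "Q x" if "x \<in> N" for x
    using that C.submoduleD(1)[OF N] unfolding Q_def by (auto intro!: bexI[of _ "\<one>\<^bsub>R\<^esub>"])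
  obtain S where S: "submodule S R C" "N \<subseteq> S" "\<And>x. x \<in> S \<Longrightarrow> Q x"
    and Smax: "\<And>T. \<lbrakk>submodule T R C; S \<subseteq> T; \<And>x. x \<in> T \<Longrightarrow> Q x\<rbrakk> \<Longrightarrow> T = S"
  proof (rule C.submodule_Zorn[OF N, of Q])
    fix S assume *: "submodule S R C" "N \<subseteq> S" "\<And>x. x \<in> S \<Longrightarrow> Q x"
      "\<And>T. \<lbrakk>submodule T R C; S \<subseteq> T; \<And>x. x \<in> T \<Longrightarrow> Q x\<rbrakk> \<Longrightarrow> T = S"
    show thesis by (rule that[OF *])
  qed (rule Q0)
  note SD = C.submoduleD[OF S(1)]
  have "submodule {\<zero>\<^bsub>C\<^esub>} R C" by (rule C.submoduleI) auto
  then obtain K where K: "submodule K R C" "\<And>x. x \<in> K \<Longrightarrow> x \<in> S \<longrightarrow> x = \<zero>\<^bsub>C\<^esub>"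
    and Kmax: "\<And>T. \<lbrakk>submodule T R C; K \<subseteq> T; \<And>x. x \<in> T \<Longrightarrow> x \<in> S \<longrightarrow> x = \<zero>\<^bsub>C\<^esub>\<rbrakk> \<Longrightarrow> T = K"
  proof (rule C.submodule_Zorn[of "{\<zero>\<^bsub>C\<^esub>}" "\<lambda>x. x \<in> S \<longrightarrow> x = \<zero>\<^bsub>C\<^esub>"])
    fix K assume *: "submodule K R C" "{\<zero>\<^bsub>C\<^esub>} \<subseteq> K" "\<And>x. x \<in> K \<Longrightarrow> x \<in> S \<longrightarrow> x = \<zero>\<^bsub>C\<^esub>"
      "\<And>T. \<lbrakk>submodule T R C; K \<subseteq> T; \<And>x. x \<in> T \<Longrightarrow> x \<in> S \<longrightarrow> x = \<zero>\<^bsub>C\<^esub>\<rbrakk> \<Longrightarrow> T = K"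
    show thesis by (rule that[OF *(1,3,4)])
  qed simp
  note KD = C.submoduleD[OF K(1)]
  \<comment> \<open>The graph of the projection from \<open>S + K\<close> to \<open>S\<close>. The
    sum may be smaller than \<open>C\<close>, so the projection is extended by the Baer
    condition.\<close>
  define G where "G = {(s \<oplus>\<^bsub>C\<^esub> k, s) |s k. s \<in> S \<and> k \<in> K}"
  have GI: "(s \<oplus>\<^bsub>C\<^esub> k, s) \<in> G" if "s \<in> S" "k \<in> K" for s k using that unfolding G_def by blast
  have SG: "(s, s) \<in> G" if "s \<in> S" for s using GI[OF that KD(2)] that SD(1) by auto
  have KG: "(k, \<zero>\<^bsub>C\<^esub>) \<in> G" if "k \<in> K" for k using GI[OF SD(2) that] that KD(1) by auto
  have G: "submodule G R (prod_module C C)"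
  proof (rule P.submoduleI)
    show "G \<subseteq> carrier (prod_module C C)" unfolding G_def using SD(1) KD(1) by auto
    show "\<zero>\<^bsub>prod_module C C\<^esub> \<in> G" using SG[OF SD(2)] by simp
  next
    fix p p' assume "p \<in> G" "p' \<in> G"
    then obtain s k s' k' where *: "p = (s \<oplus>\<^bsub>C\<^esub> k, s)" "s \<in> S" "k \<in> K"
      "p' = (s' \<oplus>\<^bsub>C\<^esub> k', s')" "s' \<in> S" "k' \<in> K" unfolding G_def by blast
    moreover from this have "s \<in> carrier C" "k \<in> carrier C" "s' \<in> carrier C" "k' \<in> carrier C"
      using SD(1) KD(1) by auto
    ultimately have "p \<oplus>\<^bsub>prod_module C C\<^esub> p' = ((s \<oplus>\<^bsub>C\<^esub> s') \<oplus>\<^bsub>C\<^esub> (k \<oplus>\<^bsub>C\<^esub> k'), s \<oplus>\<^bsub>C\<^esub> s')"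
      by (simp add: C.M.a_ac)
    then show "p \<oplus>\<^bsub>prod_module C C\<^esub> p' \<in> G" using GI SD(3) KD(3) * by simp
  next
    fix r p assume r: "r \<in> carrier R" and "p \<in> G"
    then obtain s k where *: "p = (s \<oplus>\<^bsub>C\<^esub> k, s)" "s \<in> S" "k \<in> K" unfolding G_def by blast
    moreover from this have "s \<in> carrier C" "k \<in> carrier C" using SD(1) KD(1) by auto
    ultimately have "r \<odot>\<^bsub>prod_module C C\<^esub> p = (r \<odot>\<^bsub>C\<^esub> s \<oplus>\<^bsub>C\<^esub> r \<odot>\<^bsub>C\<^esub> k, r \<odot>\<^bsub>C\<^esub> s)"
      using r by (simp add: C.smult_r_distr)
    then show "r \<odot>\<^bsub>prod_module C C\<^esub> p \<in> G" using GI SD(4) KD(4) * r by simp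
  qed
  obtain g where g: "g \<in> left_module_hom R C C" "\<And>x y. (x, y) \<in> G \<Longrightarrow> g x = y"
  proof (rule baer_extend[OF C Cm G])
    show "y = \<zero>\<^bsub>C\<^esub>" if y: "(\<zero>\<^bsub>C\<^esub>, y) \<in> G" for y
    proof -
      obtain k where k: "k \<in> K" "y \<in> S" "\<zero>\<^bsub>C\<^esub> = y \<oplus>\<^bsub>C\<^esub> k" using y unfolding G_def by blast
      moreover from this have "y \<in> carrier C" "k \<in> carrier C" using SD(1) KD(1) by blast+
      ultimately have "y = \<ominus>\<^bsub>C\<^esub> k" using C.M.minus_equality[of y k] by simp
      with k show ?thesis using K(2)[OF KD(5)[OF k(1)]] by simp
    qed
    show "\<exists>I\<in>J. \<forall>a\<in>I. a \<in> carrier R \<and> a \<odot>\<^bsub>C\<^esub> x \<in> fst ` G" if x: "x \<in> carrier C" for x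
    proof -
      have "x \<in> filter_colon N C J" using x dense by simp
      then obtain I where I: "I \<in> J" "\<forall>a\<in>I. a \<odot>\<^bsub>C\<^esub> x \<in> N" unfolding filter_colon_def by blast
      \<comment> \<open>\<open>N \<subseteq> S\<close> lies in the domain of the projection, so
        density of \<open>N\<close> suffices.\<close>
      have "a \<odot>\<^bsub>C\<^esub> x \<in> fst ` G" if "a \<in> I" for a
      proof -
        have "a \<odot>\<^bsub>C\<^esub> x \<in> S" using I(2) S(2) that by blast
        from imageI[OF SG[OF this], of fst] show ?thesis by simp
      qed
      then show ?thesis using ideal_filterD(1)[OF J I(1)] I(1) by blast
    qed
  qed (rule that)
  note gD = left_module_homD[OF g(1)]
  have gS: "g s = s" if "s \<in> S" for s using g(2)[OF SG[OF that]] .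
  have gK: "g k = \<zero>\<^bsub>C\<^esub>" if "k \<in> K" for k using g(2)[OF KG[OF that]] .
  have img: "submodule (g ` carrier C) R C"
    by (rule left_module_hom_image_submodule[OF Cm Cm g(1) C.carrier_submodule])
  have Qimg: "Q y" if yg: "y \<in> g ` carrier C" for y
    unfolding Q_def
  proof
    assume y0: "y \<noteq> \<zero>\<^bsub>C\<^esub>"
    obtain x where x: "x \<in> carrier C" "y = g x" using yg by blast
    text \<open>The cyclic submodule \<open>R y\<close> meets \<open>S\<close>: otherwise its preimage under \<open>g\<close> would be \<open>K\<close>.\<close>
    let ?B = "(\<lambda>r. r \<odot>\<^bsub>C\<^esub> y) ` carrier R"
    have yc: "y \<in> carrier C" using x gD(1) by simp
    have reg: "left_module R (regular_module R)" by (rule left_module_regular_module[OF C.R.ring_axioms])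
    have "(\<lambda>r. r \<odot>\<^bsub>C\<^esub> y) \<in> left_module_hom R (regular_module R) C"
      using yc by (simp add: left_module_hom_def C.smult_l_distr C.smult_assoc1)
    from left_module_hom_image_submodule[OF reg Cm this left_module.carrier_submodule[OF reg]]
    have B: "submodule ?B R C" by simp
    have pre: "submodule {x \<in> carrier C. g x \<in> ?B} R C"
      by (rule left_module_hom_vimage_submodule[OF Cm Cm g(1) B])
    have "\<exists>s. s \<in> S \<and> s \<in> ?B \<and> s \<noteq> \<zero>\<^bsub>C\<^esub>"
    proof (rule ccontr)
      assume neg: "\<nexists>s. s \<in> S \<and> s \<in> ?B \<and> s \<noteq> \<zero>\<^bsub>C\<^esub>"
      have "{x \<in> carrier C. g x \<in> ?B} = K"
      proof (rule Kmax[OF pre])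
        show "K \<subseteq> {x \<in> carrier C. g x \<in> ?B}" using KD(1) gK C.submoduleD(2)[OF B] by auto
        \<comment> \<open>An element of \<open>S\<close> in the preimage is its own image under
          \<open>g\<close>, hence lies in \<open>S\<close> and in \<open>R y\<close>, so it is
          zero.\<close>
        show "z \<in> S \<longrightarrow> z = \<zero>\<^bsub>C\<^esub>" if "z \<in> {x \<in> carrier C. g x \<in> ?B}" for z
          using that gS neg by auto
      qed
      moreover have "y \<in> ?B" using imageI[OF C.R.one_closed, of "\<lambda>r. r \<odot>\<^bsub>C\<^esub> y"] yc by simp
      ultimately have "x \<in> K" using x by blast
      then show False using gK x(2) y0 by simp
    qed
    then obtain r where r: "r \<in> carrier R" "r \<odot>\<^bsub>C\<^esub> y \<in> S" "r \<odot>\<^bsub>C\<^esub> y \<noteq> \<zero>\<^bsub>C\<^esub>" by blast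
    \<comment> \<open>A nonzero multiple of \<open>y\<close> in \<open>S\<close> has in turn a
      nonzero multiple in \<open>N\<close>, because elements of \<open>S\<close> satisfy
      \<open>Q\<close>.\<close>
    then obtain t where t: "t \<in> carrier R" "t \<odot>\<^bsub>C\<^esub> (r \<odot>\<^bsub>C\<^esub> y) \<in> N" "t \<odot>\<^bsub>C\<^esub> (r \<odot>\<^bsub>C\<^esub> y) \<noteq> \<zero>\<^bsub>C\<^esub>"
      using S(3)[OF r(2)] unfolding Q_def by blast
    then show "\<exists>r\<in>carrier R. r \<odot>\<^bsub>C\<^esub> y \<in> N \<and> r \<odot>\<^bsub>C\<^esub> y \<noteq> \<zero>\<^bsub>C\<^esub>"
      using C.smult_assoc1[OF t(1) r(1) yc] r(1) by (intro bexI[of _ "t \<otimes>\<^bsub>R\<^esub> r"]) auto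
  qed
  have "S \<subseteq> g ` carrier C"
  proof
    fix s assume s: "s \<in> S"
    then have "g s \<in> g ` carrier C" using SD(1) by blast
    then show "s \<in> g ` carrier C" unfolding gS[OF s] .
  qed
  then have "g ` carrier C = S" using Smax[OF img] Qimg by blast
  then have "baer R J (C\<lparr>carrier := S\<rparr>)"
    by (intro baer_retract[OF C S(1) g(1)]) (use gS in auto)
  then show ?thesis using S(3) unfolding Q_def by (intro that[OF S(1,2)]) auto
qed

section \<open>Assembling the hull\<close>

lemma J_hull_exists:
  fixes R :: "('r, 'c) ring_scheme" and M :: "('r, 'm) module"
  assumes J: "ideal_filter R J" and comp: "complete_filter TYPE('r + 'u) R J"
    and M: "left_module R M"
  obtains \<Omega> :: "('r, ('m \<Rightarrow> complex) \<Rightarrow> 'r \<Rightarrow> complex) module" and \<iota>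
  where "J_hull U R J M \<Omega> \<iota>"
proof -
  interpret M: left_module R M by fact
  \<comment> \<open>The index type of the product is \<open>'m \<Rightarrow> complex\<close>, which
    has room for all characters of \<open>M\<close>.\<close>
  let ?E = "coinduced_module R :: ('r, ('m \<Rightarrow> complex) \<Rightarrow> 'r \<Rightarrow> complex) module"
  let ?e = "character_embedding R M"
  have E: "left_module R ?E" and bE: "baer R J ?E"
    using left_module_coinduced_module baer_coinduced_module M.R.ring_axioms by blast+
  interpret E: left_module R ?E by fact
  note e = character_embedding[OF M]
  let ?N = "?e ` carrier M"
  have N: "submodule ?N R ?E"
    by (rule left_module_hom_image_submodule[OF M E e(1) M.carrier_submodule])
  \<comment> \<open>\<open>D\<close> is the largest \<open>J\<close>-extension of the image of
    \<open>M\<close> inside \<open>?E\<close>.\<close>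
  define D where "D = filter_colon ?N ?E J"
  have D: "submodule D R ?E" "?N \<subseteq> D"
    unfolding D_def by (rule filter_colon_submodule[OF E J N])+
  let ?C = "?E\<lparr>carrier := D\<rparr>"
  have C: "left_module R ?C" by (rule E.submodule_left_module[OF D(1)])
  interpret C: left_module R ?C by fact
  have bC: "baer R J ?C" unfolding D_def by (rule baer_filter_colon[OF J comp bE N])
  have NC: "submodule ?N R ?C" using N D E.submodule_restrict_iff[OF D(1)] by blast
  have mem: "\<exists>I\<in>J. \<forall>a\<in>I. a \<odot>\<^bsub>?E\<^esub> x \<in> ?N" if "x \<in> D" for x
    using that unfolding D_def filter_colon_def by blast
  have "filter_colon ?N ?C J = carrier ?C"
    using mem unfolding filter_colon_def by auto
  then obtain S where S: "submodule S R ?C" "?N \<subseteq> S" "baer R J (?C\<lparr>carrier := S\<rparr>)"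
    and ess: "\<And>x. \<lbrakk>x \<in> S; x \<noteq> \<zero>\<^bsub>?C\<^esub>\<rbrakk> \<Longrightarrow> \<exists>r\<in>carrier R. r \<odot>\<^bsub>?C\<^esub> x \<in> ?N \<and> r \<odot>\<^bsub>?C\<^esub> x \<noteq> \<zero>\<^bsub>?C\<^esub>"
    using baer_maximal_essential[OF bC J NC] by blast
  let ?O = "?E\<lparr>carrier := S\<rparr>"
  have SD: "S \<subseteq> D" using C.submoduleD(1)[OF S(1)] by simp
  \<comment> \<open>Restricting the carrier twice yields the same record as restricting it to
    \<open>S\<close> at once.\<close>
  have bO: "baer R J ?O" using S(3) by simp
  then have O: "left_module R ?O" by (simp add: baer_def)
  interpret O: left_module R ?O by fact
  have eO: "?e \<in> left_module_hom R M ?O"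
    using e(1) S(2) by (auto simp: left_module_hom_def simp del: coinduced_module_simps)
  have "J_extension R J M ?O ?e"
    unfolding J_extension_def
  proof (intro conjI M O eO e(2))
    show "filter_colon ?N ?O J = carrier ?O"
      using mem SD unfolding filter_colon_def by auto
  qed
  moreover have "essential_extension R M ?O ?e"
    unfolding essential_extension_def
  proof (intro conjI M O eO e(2) allI impI)
    fix B' assume B': "submodule B' R ?O \<and> B' \<inter> ?N = {\<zero>\<^bsub>?O\<^esub>}"
    note BD = O.submoduleD[OF conjunct1[OF B']]
    have "x = \<zero>\<^bsub>?O\<^esub>" if x: "x \<in> B'" for x
    proof (rule ccontr)
      assume "x \<noteq> \<zero>\<^bsub>?O\<^esub>"
      \<comment> \<open>A nonzero \<open>x\<close> would have a nonzero multiple in both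
        \<open>B'\<close> and the image of \<open>M\<close>.\<close>
      then obtain r where r: "r \<in> carrier R" "r \<odot>\<^bsub>?O\<^esub> x \<in> ?N" "r \<odot>\<^bsub>?O\<^esub> x \<noteq> \<zero>\<^bsub>?O\<^esub>"
        using ess[of x] x BD(1) by (auto simp del: coinduced_module_simps)
      then show False using BD(4)[OF r(1) x] B' by blast
    qed
    then show "B' = {\<zero>\<^bsub>?O\<^esub>}" using BD(2) by blast
  qed
  ultimately have "J_hull U R J M ?O ?e"
    using baer_imp_J_injective[OF bO J] by (simp add: J_hull_def)
  then show ?thesis by (rule that)
qed

theorem theorem2p29:
  fixes R :: "('r, 'c) ring_scheme" and J :: "'r set set" and M :: "('r, 'm) module"
  assumes "ring R"
    and "ideal_filter R J"
    and "complete_filter TYPE('r + 'u) R J"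
    and "left_module R M"
  shows "(\<exists>(\<Omega> :: ('r, ('m \<Rightarrow> complex) \<Rightarrow> 'r \<Rightarrow> complex) module) \<iota>.
            J_hull TYPE('r + 'u) R J M \<Omega> \<iota>) \<and>
         (\<forall>(\<Omega> :: ('r, 'w) module) \<iota>. J_hull TYPE('r + 'u) R J M \<Omega> \<iota> \<longrightarrow>
            (\<forall>(N :: ('r, 'n) module) i.
               J_extension R J M N i \<and> essential_extension R M N i \<longrightarrow>
               (\<exists>j. J_hull TYPE('r + 'u) R J N \<Omega> j \<and> (\<forall>x\<in>carrier M. j (i x) = \<iota> x))) \<and>
            (\<forall>(\<Omega>' :: ('r, 'v) module) \<iota>'. J_hull TYPE('r + 'u) R J M \<Omega>' \<iota>' \<longrightarrow>
               (\<exists>\<phi> \<in> left_module_hom R \<Omega> \<Omega>'. bij_betw \<phi> (carrier \<Omega>) (carrier \<Omega>') \<and>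
                  (\<forall>x\<in>carrier M. \<phi> (\<iota> x) = \<iota>' x))))"
proof (intro conjI allI impI; (elim conjE)?)
  show "\<exists>(\<Omega> :: ('r, ('m \<Rightarrow> complex) \<Rightarrow> 'r \<Rightarrow> complex) module) \<iota>. J_hull TYPE('r + 'u) R J M \<Omega> \<iota>"
    using J_hull_exists[OF assms(2-4)] by metis
  fix \<Omega> :: "('r, 'w) module" and \<iota> assume hull: "J_hull TYPE('r + 'u) R J M \<Omega> \<iota>"
  \<comment> \<open>\<open>N\<close>, \<open>\<Omega>\<close> and \<open>\<Omega>'\<close> live on
    types unrelated to the test type \<open>'r + 'u\<close>. The Baer condition speaks of left
    ideals only, so it can be used against modules on any of them.\<close>
  then have bO: "baer R J \<Omega>"
    using J_injective_imp_baer[OF assms(1,2)] unfolding J_hull_def by blast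
  show "\<exists>j. J_hull TYPE('r + 'u) R J N \<Omega> j \<and> (\<forall>x\<in>carrier M. j (i x) = \<iota> x)"
    if "J_extension R J M N i" "essential_extension R M N i" for N :: "('r, 'n) module" and i
    by (rule J_hull_extend[OF assms(2) hull bO that])
  show "\<exists>\<phi> \<in> left_module_hom R \<Omega> \<Omega>'. bij_betw \<phi> (carrier \<Omega>) (carrier \<Omega>') \<and>
                  (\<forall>x\<in>carrier M. \<phi> (\<iota> x) = \<iota>' x)"
    if hull': "J_hull TYPE('r + 'u) R J M \<Omega>' \<iota>'" for \<Omega>' :: "('r, 'v) module" and \<iota>'
  proof -
    have "baer R J \<Omega>'"
      using J_injective_imp_baer[OF assms(1,2)] hull' unfolding J_hull_def by blast
    then show ?thesis by (rule J_hull_unique[OF assms(2) hull bO hull'])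
  qed
qed

end
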